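(* Let $(\Gamma,\psi),(\Gamma',\psi')$ be two GBS graphs with a bijection $V(\Gamma)=V(\Gamma')$, and let $\Lambda,\Lambda'$ be their affine representations. Then the following are equivalent: 1. There is a sequence of slides, swaps and connections going from $(\Gamma,\psi)$ to $(\Gamma',\psi')$ inducing the given bijection. 2. The sets of primes of $(\Gamma,\psi)$ and $(\Gamma',\psi')$ coincide (so that $V(\Lambda)=V(\Lambda')$ via the given bijection), and for every quasi-conjugacy class $Q\subseteq V(\Lambda)$ there is a sequence of swaps, connections, internal slides and external slides, each of them involving only edges in $Q$, going from the configuration of $Q$ in $(\Gamma,\psi)$ to the configuration of $Q$ in $(\Gamma',\psi')$.
   Context: A graph (in the sense of Serre) has a vertex set $V$, an edge set $E$, a fixed-point-free involution $e\mapsto\bar e$ on $E$, an initial-vertex map $\iota:E\to V$, and $\tau(e)=\iota(\bar e)$. A GBS graph $(\Gamma,\psi)$ is a finite connected graph $\Gamma$ together with a function $\psi:E(\Gamma)\to\mathbb Z\setminus\{0\}$. Let $\mathcal P=\mathcal P(\Gamma,\psi)$ (the set of primes) be the finite set of primes dividing some $\psi(e)$, and let $\mathbf A=\mathbb Z/2\mathbb Z\oplus\bigoplus_{r\in\mathcal P}\mathbb Z$. For $\mathbf a=(a_0,(a_r)_{r\in\mathcal P})\in\mathbf A$ write $\mathbf a\ge\mathbf 0$ if $a_r\ge0$ for all $r\in\mathcal P$ (no condition on $a_0$); put $\mathbf A^+=\{\mathbf a\in\mathbf A:\mathbf a\ge\mathbf 0\}$. The affine representation $\Lambda$ of $(\Gamma,\psi)$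 is the graph with $V(\Lambda)=V(\Gamma)\times\mathbf A^+$, $E(\Lambda)=E(\Gamma)$ with the same reverse map, and terminal vertices $\tau_\Lambda(e)=(\tau_\Gamma(e),(a_0,(a_r)_r))$ where $\psi(e)=(-1)^{a_0}\prod_{r}r^{a_r}$. Below $\iota(e),\tau(e)$ denote endpoints in $\Lambda$. For $p=(v,\mathbf a)\in V(\Lambda)$ and $\mathbf w\in\mathbf A^+$ put $p+\mathbf w=(v,\mathbf a+\mathbf w)$, and write $p\le p'$ if $p'=p+\mathbf w$ for some $\mathbf w\in\mathbf A^+$. An affine path from $p$ to $p'$ is a sequence of edges $(e_1,\dots,e_\ell)$, $\ell\ge0$, for which there are $\mathbf w_1,\dots,\mathbf w_\ell\in\mathbf A^+$ with $\iota(e_1)+\mathbf w_1=p$, $\tau(e_\ell)+\mathbf w_\ell=p'$ and $\tau(e_i)+\mathbf w_i=\iota(e_{i+1})+\mathbf w_{i+1}$ for $1\le i<\ell$ (the empty path goes from $p$ to $p$). Write $p\sim_{\mathrm c}q$ (conjugate) if there is an affine path from $p$ to $q$; $p\preceq_{\mathrm c}q$ if $p\le q'$ for some $q'\sim_{\mathrm c}q$; $p\sim_{\mathrm{qc}}q$ (quasi-conjugate) if $p\preceq_{\mathrm c}q$ and $q\preceq_{\mathrm c}p$. An edge $e$ is quasi-conjugate to $p$, and belongs to the quasi-conjugacy class $Q$ of $p$, if $\iota(e)\sim_{\mathrm{qc}}p$ (equivalently $\tau(e)\sim_{\mathrm{qc}}p$). For $p\sim_{\mathrm{qc}}q$, we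 say that $p,q$ are externally equivalent, $p\sim_{\mathrm{ee}}q$, if there is an affine path from $p$ to $q$ which does not use any edge quasi-conjugate to $p$ and $q$. Moves, described on the affine representation ($p\,\text{---}\,q$ denotes an edge of $\Lambda$ with endpoints $p,q$; the two edges involved are distinct, all other edges are unchanged, and the vertex set of $\Gamma$ is unchanged, so a sequence of moves induces a bijection of vertex sets): Slide: given edges $p\,\text{---}\,q$ and $r\,\text{---}\,p+\mathbf a$ with $\mathbf a\in\mathbf A^+$, replace the second by $r\,\text{---}\,q+\mathbf a$. The slide is internal if the two edges belong to the same quasi-conjugacy class. Swap: given $p\,\text{---}\,p+\mathbf w_1$ and $q\,\text{---}\,q+\mathbf w_2$ with $\mathbf w_1,\mathbf w_2\in\mathbf A^+$, $p\le q\le p+k_1\mathbf w_1$ and $p\le q\le p+k_2\mathbf w_2$ for some $k_1,k_2\in\mathbb N$, replace them by $q\,\text{---}\,q+\mathbf w_1$ and $p\,\text{---}\,p+\mathbf w_2$. Connection: given $q\,\text{---}\,p+\mathbf w_1$ and $p\,\text{---}\,p+\mathbf w$ with $\mathbf w,\mathbf w_1,\mathbf w_2\in\mathbf A^+$ and $\mathbf w_1+\mathbf w_2=k\mathbf w$ for some $k\in\mathbb N$, replace them by $p\,\text{---}\,q+\mathbf w_2$ and $q\,\text{---}\,q+\mathbf w$. External slide: replace an edge $p\,\text{---}\,q$ by $p\,\text{---}\,q'$ where $q\sim_{\mathrm{ee}}q'$; this is regarded as involving only the edge $p\,\text{---}\,q$. The configuration of $Q$ in $(\Gamma,\psi)$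 (resp. $(\Gamma',\psi')$) is the collection of edges of $\Lambda$ (resp. $\Lambda'$) having an endpoint in $Q$, recorded through their pairs of endpoints. In item 2 the moves are applied starting from $(\Gamma,\psi)$ and leave all edges outside $Q$ unchanged. *)

theory Defs
  imports
    "Graph_Theory.Digraph_Component"
    "HOL-Library.Poly_Mapping"
    "HOL-Library.Product_Plus"
    "HOL-Library.Z2"
    "HOL-Computational_Algebra.Primes"
begin

section \<open>GBS graphs\<close>

text \<open>
  A graph in the sense of Serre is a \<^locale>\<open>bidirected_digraph\<close>: \<open>arcs\<close> is the set of oriented
  edges, \<open>tail\<close> and \<open>head\<close> are the initial and terminal vertex, and \<open>einv\<close> is the fixed-point-free
  reversal of edges (by library convention it is the identity outside of \<open>arcs\<close>).
\<close>

record ('v, 'e) pre_gbs =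
  underlying :: "('v, 'e) pre_digraph"
  einv :: "'e \<Rightarrow> 'e"
  label :: "'e \<Rightarrow> int"

locale gbs_graph =
  bidirected_digraph "underlying G" "einv G" + fin_digraph "underlying G"
  for G :: "('v, 'e) pre_gbs" +
  assumes underlying_connected: "connected (underlying G)"
    and label_nonzero: "e \<in> arcs (underlying G) \<Longrightarrow> label G e \<noteq> 0"

definition primes_of :: "('v, 'e) pre_gbs \<Rightarrow> nat set" where
  "primes_of G = {r. prime r \<and> (\<exists>e \<in> arcs (underlying G). int r dvd label G e)}"

definition gbs_iso_over ::
  "('v \<Rightarrow> 'w) \<Rightarrow> ('v, 'e) pre_gbs \<Rightarrow> ('w, 'f) pre_gbs \<Rightarrow> bool" where
  "gbs_iso_over \<beta> G H \<longleftrightarrow>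
     bij_betw \<beta> (verts (underlying G)) (verts (underlying H)) \<and>
     (\<exists>\<phi>. bij_betw \<phi> (arcs (underlying G)) (arcs (underlying H)) \<and>
       (\<forall>e \<in> arcs (underlying G).
          \<phi> (einv G e) = einv H (\<phi> e) \<and>
          tail (underlying H) (\<phi> e) = \<beta> (tail (underlying G) e) \<and>
          head (underlying H) (\<phi> e) = \<beta> (head (underlying G) e) \<and>
          label H (\<phi> e) = label G e))"


section \<open>The group \<open>A\<close> and its positive cone\<close>

text \<open>
  Elements of \<open>A\<close> are pairs of an element of \<open>Z/2Z\<close> and a finitely supported function from the
  naturals to the integers; \<open>A\<close> itself, for a set \<open>P\<close> of primes, consists of the pairs supported
  in \<open>P\<close>.  The type carries the (componentwise) group structure.
\<close>

type_synonym avec = "bit \<times> (nat \<Rightarrow>\<^sub>0 int)"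

definition avecs :: "nat set \<Rightarrow> avec set" where
  "avecs P = {a. Poly_Mapping.keys (snd a) \<subseteq> P}"

definition avecs_nonneg :: "nat set \<Rightarrow> avec set" where
  "avecs_nonneg P = {a \<in> avecs P. \<forall>r \<in> P. Poly_Mapping.lookup (snd a) r \<ge> 0}"

definition nmult :: "nat \<Rightarrow> avec \<Rightarrow> avec" (infixr "*\<^sub>a" 70) where
  "k *\<^sub>a w = (\<Sum>i<k. w)"

definition avec_of_int :: "int \<Rightarrow> avec" where
  "avec_of_int x =
     (if x < 0 then 1 else 0,
      \<Sum>r \<in> prime_factors (nat \<bar>x\<bar>). Poly_Mapping.single r (int (multiplicity r (nat \<bar>x\<bar>))))"

lemma lookup_avec_of_int:
  "Poly_Mapping.lookup (snd (avec_of_int x)) r =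
     (if r \<in> prime_factors (nat \<bar>x\<bar>) then int (multiplicity r (nat \<bar>x\<bar>)) else 0)"
  by (simp add: avec_of_int_def lookup_sum lookup_single when_def)

lemma keys_avec_of_int:
  "Poly_Mapping.keys (snd (avec_of_int x)) = prime_factors (nat \<bar>x\<bar>)"
proof -
  have "multiplicity r (nat \<bar>x\<bar>) > 0" if "r \<in> prime_factors (nat \<bar>x\<bar>)" for r
    using that by (simp add: prime_factors_multiplicity)
  then show ?thesis
    by (auto simp: in_keys_iff lookup_avec_of_int split: if_splits)
qed

lemma avec_of_int_factorisation:
  assumes "x \<noteq> 0"
  shows "x = (if fst (avec_of_int x) = 0 then 1 else - 1) *
    (\<Prod>r \<in> Poly_Mapping.keys (snd (avec_of_int x)).
       int r ^ nat (Poly_Mapping.lookup (snd (avec_of_int x)) r))"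
proof -
  have "(\<Prod>r \<in> prime_factors (nat \<bar>x\<bar>).
       int r ^ nat (Poly_Mapping.lookup (snd (avec_of_int x)) r))
     = int (\<Prod>r \<in> prime_factors (nat \<bar>x\<bar>). r ^ multiplicity r (nat \<bar>x\<bar>))"
    by (simp add: lookup_avec_of_int)
  also have "\<dots> = \<bar>x\<bar>"
    using assms by (subst prod_prime_factors) auto
  finally show ?thesis
    by (simp add: keys_avec_of_int) (simp add: avec_of_int_def)
qed


section \<open>The affine representation\<close>

type_synonym 'v point = "'v \<times> avec"

definition translate :: "'v point \<Rightarrow> avec \<Rightarrow> 'v point" (infixl "+\<^sub>a" 65) where
  "p +\<^sub>a w = (fst p, snd p + w)"

definition affine_rep :: "('v, 'e) pre_gbs \<Rightarrow> ('v point, 'e) pre_digraph" where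
  "affine_rep G =
     \<lparr>verts = verts (underlying G) \<times> avecs_nonneg (primes_of G),
      arcs = arcs (underlying G),
      tail = (\<lambda>e. (head (underlying G) (einv G e), avec_of_int (label G (einv G e)))),
      head = (\<lambda>e. (head (underlying G) e, avec_of_int (label G e)))\<rparr>"

definition cone :: "('v, 'e) pre_gbs \<Rightarrow> avec set" where
  "cone G = avecs_nonneg (primes_of G)"

definition point_le :: "('v, 'e) pre_gbs \<Rightarrow> 'v point \<Rightarrow> 'v point \<Rightarrow> bool" where
  "point_le G p p' \<longleftrightarrow> (\<exists>w \<in> cone G. p' = p +\<^sub>a w)"

fun affine_path :: "('v, 'e) pre_gbs \<Rightarrow> 'v point \<Rightarrow> 'e list \<Rightarrow> 'v point \<Rightarrow> bool" where
  "affine_path G p [] p' \<longleftrightarrow> p \<in> verts (affine_rep G) \<and> p = p'"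
| "affine_path G p (e # es) p' \<longleftrightarrow>
     e \<in> arcs (affine_rep G) \<and>
     (\<exists>w \<in> cone G. tail (affine_rep G) e +\<^sub>a w = p \<and>
        affine_path G (head (affine_rep G) e +\<^sub>a w) es p')"

definition conjugate :: "('v, 'e) pre_gbs \<Rightarrow> 'v point \<Rightarrow> 'v point \<Rightarrow> bool" where
  "conjugate G p q \<longleftrightarrow> (\<exists>es. affine_path G p es q)"

definition conj_le :: "('v, 'e) pre_gbs \<Rightarrow> 'v point \<Rightarrow> 'v point \<Rightarrow> bool" where
  "conj_le G p q \<longleftrightarrow>
     p \<in> verts (affine_rep G) \<and> (\<exists>q'. conjugate G q' q \<and> point_le G p q')"

definition quasi_conj :: "('v, 'e) pre_gbs \<Rightarrow> 'v point \<Rightarrow> 'v point \<Rightarrow> bool" where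
  "quasi_conj G p q \<longleftrightarrow> conj_le G p q \<and> conj_le G q p"

definition quasi_conj_classes :: "('v, 'e) pre_gbs \<Rightarrow> 'v point set set" where
  "quasi_conj_classes G = verts (affine_rep G) // {(p, q). quasi_conj G p q}"

definition edge_quasi_conj :: "('v, 'e) pre_gbs \<Rightarrow> 'e \<Rightarrow> 'v point \<Rightarrow> bool" where
  "edge_quasi_conj G e p \<longleftrightarrow> quasi_conj G (tail (affine_rep G) e) p"

definition ext_equiv :: "('v, 'e) pre_gbs \<Rightarrow> 'v point \<Rightarrow> 'v point \<Rightarrow> bool" where
  "ext_equiv G p q \<longleftrightarrow> quasi_conj G p q \<and>
     (\<exists>es. affine_path G p es q \<and> (\<forall>e \<in> set es. \<not> edge_quasi_conj G e p))"


section \<open>Moves\<close>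

text \<open>
  Edges are oriented, so letting \<open>e\<close> range over all edges covers both ways of reading
  an unoriented edge with endpoints \<open>p\<close> and \<open>q\<close>.
\<close>

abbreviation ends :: "('v, 'e) pre_gbs \<Rightarrow> 'e \<Rightarrow> 'v point \<times> 'v point" where
  "ends G e \<equiv> arc_to_ends (affine_rep G) e"

text \<open>
  \<open>modifies G S G'\<close>: the GBS graph \<open>G'\<close> has the same vertices, edges and reversal as the GBS graph
  \<open>G\<close>, and the affine representations agree on all edges, except possibly those in \<open>S\<close> and
  their reverses.
\<close>

definition modifies :: "('v, 'e) pre_gbs \<Rightarrow> 'e set \<Rightarrow> ('v, 'e) pre_gbs \<Rightarrow> bool" where
  "modifies G S G' \<longleftrightarrow> gbs_graph G \<and> gbs_graph G' \<and>
     verts (underlying G') = verts (underlying G) \<and>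
     arcs (underlying G') = arcs (underlying G) \<and>
     einv G' = einv G \<and>
     (\<forall>e \<in> arcs (underlying G) - (S \<union> einv G ` S). ends G' e = ends G e)"

definition distinct_edges :: "('v, 'e) pre_gbs \<Rightarrow> 'e \<Rightarrow> 'e \<Rightarrow> bool" where
  "distinct_edges G e f \<longleftrightarrow>
     e \<in> arcs (underlying G) \<and> f \<in> arcs (underlying G) \<and> f \<noteq> e \<and> f \<noteq> einv G e"

definition slide :: "('v, 'e) pre_gbs \<Rightarrow> 'e \<Rightarrow> 'e \<Rightarrow> ('v, 'e) pre_gbs \<Rightarrow> bool" where
  "slide G e f G' \<longleftrightarrow> distinct_edges G e f \<and> modifies G {f} G' \<and>
     (\<exists>p q r. \<exists>a \<in> cone G.
        ends G e = (p, q) \<and> ends G f = (r, p +\<^sub>a a) \<and>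
        ends G' f = (r, q +\<^sub>a a))"

definition internal_slide :: "('v, 'e) pre_gbs \<Rightarrow> 'e \<Rightarrow> 'e \<Rightarrow> ('v, 'e) pre_gbs \<Rightarrow> bool" where
  "internal_slide G e f G' \<longleftrightarrow>
     slide G e f G' \<and> edge_quasi_conj G e (tail (affine_rep G) f)"

definition swap :: "('v, 'e) pre_gbs \<Rightarrow> 'e \<Rightarrow> 'e \<Rightarrow> ('v, 'e) pre_gbs \<Rightarrow> bool" where
  "swap G e f G' \<longleftrightarrow> distinct_edges G e f \<and> modifies G {e, f} G' \<and>
     (\<exists>p q. \<exists>w1 \<in> cone G. \<exists>w2 \<in> cone G. \<exists>k1 k2.
        point_le G p q \<and> point_le G q (p +\<^sub>a k1 *\<^sub>a w1) \<and> point_le G q (p +\<^sub>a k2 *\<^sub>a w2) \<and>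
        ends G e = (p, p +\<^sub>a w1) \<and> ends G f = (q, q +\<^sub>a w2) \<and>
        ends G' e = (q, q +\<^sub>a w1) \<and> ends G' f = (p, p +\<^sub>a w2))"

definition connection :: "('v, 'e) pre_gbs \<Rightarrow> 'e \<Rightarrow> 'e \<Rightarrow> ('v, 'e) pre_gbs \<Rightarrow> bool" where
  "connection G e f G' \<longleftrightarrow> distinct_edges G e f \<and> modifies G {e, f} G' \<and>
     (\<exists>p q. \<exists>w \<in> cone G. \<exists>w1 \<in> cone G. \<exists>w2 \<in> cone G. \<exists>k.
        w1 + w2 = k *\<^sub>a w \<and>
        ends G e = (q, p +\<^sub>a w1) \<and> ends G f = (p, p +\<^sub>a w) \<and>
        ends G' e = (p, q +\<^sub>a w2) \<and> ends G' f = (q, q +\<^sub>a w))"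

definition external_slide :: "('v, 'e) pre_gbs \<Rightarrow> 'e \<Rightarrow> ('v, 'e) pre_gbs \<Rightarrow> bool" where
  "external_slide G f G' \<longleftrightarrow> f \<in> arcs (underlying G) \<and> modifies G {f} G' \<and>
     (\<exists>p q q'. ext_equiv G q q' \<and> ends G f = (p, q) \<and> ends G' f = (p, q'))"

definition gbs_move :: "('v, 'e) pre_gbs \<Rightarrow> ('v, 'e) pre_gbs \<Rightarrow> bool" where
  "gbs_move G G' \<longleftrightarrow> (\<exists>e f. slide G e f G' \<or> swap G e f G' \<or> connection G e f G')"

definition edges_of_class :: "('v, 'e) pre_gbs \<Rightarrow> 'v point set \<Rightarrow> 'e set" where
  "edges_of_class G Q = {e \<in> arcs (affine_rep G). tail (affine_rep G) e \<in> Q}"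

definition move_within ::
  "'v point set \<Rightarrow> ('v, 'e) pre_gbs \<Rightarrow> ('v, 'e) pre_gbs \<Rightarrow> bool" where
  "move_within Q G G' \<longleftrightarrow>
     (\<exists>e \<in> edges_of_class G Q. \<exists>f \<in> edges_of_class G Q.
        swap G e f G' \<or> connection G e f G' \<or> internal_slide G e f G') \<or>
     (\<exists>f \<in> edges_of_class G Q. external_slide G f G')"


section \<open>Configurations\<close>

text \<open>
  The multiset of the endpoint sets \<open>{p, q}\<close> (a singleton if \<open>p = q\<close>) of the geometric
  edges \<open>{e, einv e}\<close> with an endpoint in \<open>Q\<close>; note that the image of \<open>{e, einv e}\<close> under \<open>tail\<close> is
  the set of endpoints of \<open>e\<close>.
\<close>

definition configuration ::
  "('v, 'e) pre_gbs \<Rightarrow> 'v point set \<Rightarrow> 'v point set multiset" where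
  "configuration G Q =
     image_mset (\<lambda>d. tail (affine_rep G) ` d)
       (mset_set {{e, einv G e} | e. e \<in> arcs (affine_rep G) \<and>
          (tail (affine_rep G) e \<in> Q \<or> head (affine_rep G) e \<in> Q)})"

definition point_map :: "('v \<Rightarrow> 'w) \<Rightarrow> 'v point \<Rightarrow> 'w point" where
  "point_map \<beta> = map_prod \<beta> id"

end

theory Submission
  imports Defs
begin

text \<open>
  Every slide, swap and connection replaces edges by edges whose endpoints are already joined by
  affine paths over the two edges involved, and each move is undone by a move of the same kind.
  So moves change neither the primes nor conjugacy (\<open>premove_primes_of\<close>, \<open>premove_conj_via\<close>), and
  hence neither the quasi-conjugacy classes nor the class that a given edge belongs to.  Both edges
  of a swap or a connection lie in one class; in a slide the class of the moving edge lies weakly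
  above the class of the edge it slides over (\<open>elementary_classes\<close>).  Therefore the edges
  can be sorted by class, and the only interaction between different classes is that an edge slides
  over edges of strictly lower classes.

  What a class \<open>Q\<close> sees of the other classes is thus only the relation on \<open>Q\<close> generated by the
  edges that lie strictly below \<open>Q\<close>, and this relation is external equivalence
  (\<open>ext_equiv_iff\<close>).  It is an invariant too: a move of an edge strictly below \<open>Q\<close> only involves
  edges strictly below \<open>Q\<close>.  The relation \<open>similar\<close> collects all these invariants; two similar
  graphs allow the same moves inside \<open>Q\<close> as soon as they agree on the edges of \<open>Q\<close>.

  From moves to classes: a sequence of moves is replayed on a copy of \<open>G\<close> in which only the edges
  of \<open>Q\<close> are updated.  Moves elsewhere disappear, and a slide of an edge of \<open>Q\<close> over a lower edge
  becomes an external slide (\<open>move_seen_from_class\<close>).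

  From classes to moves: finitely many classes contain edges, and they are treated one after the
  other.  A sequence of moves inside \<open>Q\<close> remains possible after the edges of other classes have been
  changed, and an external slide unfolds into slides along the path that witnesses external
  equivalence (\<open>move_within_elsewhere\<close>, \<open>path_slides\<close>).  Once all classes have the configurations
  of \<open>G'\<close>, each pair of endpoints belongs to equally many edges in both graphs, which gives an
  isomorphism over the bijection of vertices (\<open>gbs_iso_over_if_ends_match\<close>).

  Intermediate graphs are built from prescribed endpoints in the affine representation
  (\<open>move_exists\<close>).  That they are connected is not automatic: it follows from the invariance
  of conjugacy, which is why paths and moves are studied for possibly disconnected graphs first.
\<close>

(* Otherwise quantified points become triples, to which rules about points no longer apply. *)
declare split_paired_All [simp del] split_paired_Ex [simp del]

section \<open>Nonnegative vectors and nonzero integers\<close>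

abbreviation atail :: "('v, 'e) pre_gbs \<Rightarrow> 'e \<Rightarrow> 'v point" where
  "atail G e \<equiv> tail (affine_rep G) e"

abbreviation ahead :: "('v, 'e) pre_gbs \<Rightarrow> 'e \<Rightarrow> 'v point" where
  "ahead G e \<equiv> head (affine_rep G) e"

abbreviation points :: "('v, 'e) pre_gbs \<Rightarrow> 'v point set" where
  "points G \<equiv> verts (affine_rep G)"

abbreviation support :: "avec \<Rightarrow> nat set" where
  "support a \<equiv> Poly_Mapping.keys (snd a)"

lemma avecs_nonneg_iff:
  "a \<in> avecs_nonneg P \<longleftrightarrow> support a \<subseteq> P \<and> (\<forall>r. 0 \<le> Poly_Mapping.lookup (snd a) r)"
  unfolding avecs_nonneg_def avecs_def
  by (auto simp: in_keys_iff subset_iff) (metis order_refl)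

text \<open>
  Nonnegative coordinates cannot cancel.  This is the reason why moves preserve the set of primes.
\<close>

lemma support_add_nonneg:
  assumes "a \<in> avecs_nonneg P" "b \<in> avecs_nonneg P"
  shows "support (a + b) = support a \<union> support b"
proof -
  have "Poly_Mapping.lookup (snd a) r + Poly_Mapping.lookup (snd b) r \<noteq> 0 \<longleftrightarrow>
     Poly_Mapping.lookup (snd a) r \<noteq> 0 \<or> Poly_Mapping.lookup (snd b) r \<noteq> 0" for r
    using assms by (simp add: avecs_nonneg_iff add_nonneg_eq_0_iff)
  then show ?thesis by (auto simp: in_keys_iff lookup_add)
qed

lemma zero_in_avecs_nonneg [simp]: "0 \<in> avecs_nonneg P"
  by (simp add: avecs_nonneg_iff)

lemma add_in_avecs_nonneg [simp]:
  "a \<in> avecs_nonneg P \<Longrightarrow> b \<in> avecs_nonneg P \<Longrightarrow> a + b \<in> avecs_nonneg P"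
  using support_add_nonneg[of a P b] by (auto simp: avecs_nonneg_iff lookup_add)

lemma nmult_0 [simp]: "0 *\<^sub>a w = 0"
  by (simp add: nmult_def)

lemma nmult_Suc [simp]: "Suc k *\<^sub>a w = k *\<^sub>a w + w"
  by (simp add: nmult_def)

lemma nmult_in_avecs_nonneg [simp]: "w \<in> avecs_nonneg P \<Longrightarrow> k *\<^sub>a w \<in> avecs_nonneg P"
  by (induction k) auto

lemma support_nmult_subset: "w \<in> avecs_nonneg P \<Longrightarrow> support (k *\<^sub>a w) \<subseteq> support w"
proof (induction k)
  case (Suc k)
  then show ?case using support_add_nonneg[of "k *\<^sub>a w" P w] by simp
qed simp

lemma translate_0 [simp]: "p +\<^sub>a 0 = p"
  by (simp add: translate_def)

lemma translate_translate: "p +\<^sub>a u +\<^sub>a w = p +\<^sub>a (u + w)"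
  by (simp add: translate_def add.assoc)

lemma translate_commute: "p +\<^sub>a u +\<^sub>a w = p +\<^sub>a w +\<^sub>a u"
  by (simp add: translate_def ac_simps)

lemma fst_translate [simp]: "fst (p +\<^sub>a w) = fst p"
  and snd_translate [simp]: "snd (p +\<^sub>a w) = snd p + w"
  by (simp_all add: translate_def)

definition int_of_avec :: "avec \<Rightarrow> int" where
  "int_of_avec a = (if fst a = 0 then 1 else - 1) *
     (\<Prod>r \<in> support a. int r ^ nat (Poly_Mapping.lookup (snd a) r))"

lemma avec_of_int_inject:
  assumes "x \<noteq> 0" "y \<noteq> 0" "avec_of_int x = avec_of_int y"
  shows "x = y"
  using avec_of_int_factorisation[OF assms(1)] avec_of_int_factorisation[OF assms(2)] assms(3)
  by simp

text \<open>
  Every point of the affine representation is the endpoint of a possible edge: a nonnegative vector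
  supported on primes comes from an integer label.
\<close>

lemma avec_of_int_of_avec:
  assumes a: "a \<in> avecs_nonneg P" and P: "\<And>r. r \<in> P \<Longrightarrow> prime r"
  shows "int_of_avec a \<noteq> 0" "avec_of_int (int_of_avec a) = a"
proof -
  define n where "n = (\<Prod>r \<in> support a. r ^ nat (Poly_Mapping.lookup (snd a) r))"
  have pr: "prime r" if "r \<in> support a" for r
    using that a P by (auto simp: avecs_nonneg_iff)
  have n0: "n > 0"
    unfolding n_def by (rule prod_pos) (use pr prime_gt_0_nat in auto)
  have i: "int_of_avec a = (if fst a = 0 then 1 else - 1) * int n"
    by (simp add: int_of_avec_def n_def)
  show "int_of_avec a \<noteq> 0"
    using n0 by (simp add: i)
  have nabs: "nat \<bar>int_of_avec a\<bar> = n"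
    by (simp add: i abs_mult)
  have mult: "multiplicity r n = nat (Poly_Mapping.lookup (snd a) r)" if "prime r" for r
    unfolding n_def using pr that
    by (subst multiplicity_prod_prime_powers) (auto simp: in_keys_iff)
  have look: "Poly_Mapping.lookup (snd (avec_of_int (int_of_avec a))) r =
      Poly_Mapping.lookup (snd a) r" for r
  proof (cases "prime r")
    case True
    then show ?thesis
      using a n0 mult[OF True]
      by (auto simp: lookup_avec_of_int nabs prime_factors_multiplicity avecs_nonneg_iff)
         (metis order.order_iff_strict)
  next
    case False
    with pr have "Poly_Mapping.lookup (snd a) r = 0" by (auto simp: in_keys_iff)
    with False show ?thesis by (auto simp: lookup_avec_of_int)
  qed
  have "fst (avec_of_int (int_of_avec a)) = fst a"
    using n0 by (cases "fst a") (auto simp: avec_of_int_def i)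
  with look show "avec_of_int (int_of_avec a) = a"
    by (intro prod_eqI poly_mapping_eqI) auto
qed

section \<open>Affine representations and affine paths\<close>

text \<open>
  A GBS graph that may be disconnected.  The notions of paths and conjugacy work here unchanged,
  so connectedness of a modified graph can be deduced from them.
\<close>

locale affine_graph =
  bidirected_digraph "underlying G" "einv G" + fin_digraph "underlying G"
  for G :: "('v, 'e) pre_gbs" +
  assumes label_nonzero: "e \<in> arcs (underlying G) \<Longrightarrow> label G e \<noteq> 0"

lemma gbs_graph_iff:
  "gbs_graph G \<longleftrightarrow> affine_graph G \<and> connected (underlying G)"
  unfolding gbs_graph_def affine_graph_def gbs_graph_axioms_def affine_graph_axioms_def by auto

lemma gbs_graphD: "gbs_graph G \<Longrightarrow> affine_graph G"
  by (simp add: gbs_graph_iff)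

lemma arcs_affine_rep [simp]: "arcs (affine_rep G) = arcs (underlying G)"
  by (simp add: affine_rep_def)

lemma points_def: "points G = verts (underlying G) \<times> cone G"
  by (simp add: affine_rep_def cone_def)

lemma translate_in_points [simp]:
  "p \<in> points G \<Longrightarrow> w \<in> cone G \<Longrightarrow> p +\<^sub>a w \<in> points G"
  by (simp add: points_def cone_def mem_Times_iff)

lemma ends_eq: "ends G e = (atail G e, ahead G e)"
  by (simp add: arc_to_ends_def)

lemma ahead_einv [simp]: "ahead G (einv G e) = atail G e"
  by (simp add: affine_rep_def)

lemma fst_ahead: "fst (ahead G e) = head (underlying G) e"
  and snd_ahead: "snd (ahead G e) = avec_of_int (label G e)"
  by (simp_all add: affine_rep_def)

lemma (in affine_graph) fst_atail: "e \<in> arcs (underlying G) \<Longrightarrow> fst (atail G e) = tail (underlying G) e"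
  by (simp add: affine_rep_def)

lemma (in affine_graph) atail_einv [simp]: "atail G (einv G e) = ahead G e"
  by (simp add: affine_rep_def)

lemma (in affine_graph) primes_of_conv:
  "primes_of G = (\<Union>e \<in> arcs (underlying G). support (snd (ahead G e)))"
  using label_nonzero
  by (auto simp: primes_of_def snd_ahead keys_avec_of_int in_prime_factors_iff
      int_dvd_int_iff[symmetric] simp del: int_dvd_int_iff) 

lemma (in affine_graph) ahead_in_points [simp]:
  assumes "e \<in> arcs (underlying G)" shows "ahead G e \<in> points G"
proof -
  have "snd (ahead G e) \<in> cone G"
    unfolding cone_def avecs_nonneg_iff using assms
    by (auto simp: primes_of_conv) (simp add: snd_ahead lookup_avec_of_int)
  then show ?thesis
    using assms by (cases "ahead G e") (auto simp: points_def fst_ahead[symmetric] dest: head_in_verts)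
qed

lemma (in affine_graph) atail_in_points [simp]:
  "e \<in> arcs (underlying G) \<Longrightarrow> atail G e \<in> points G"
  using ahead_in_points[of "einv G e"] by simp

lemma prime_if_primes_of: "r \<in> primes_of G \<Longrightarrow> prime r"
  by (simp add: primes_of_def)

lemma affine_path_append:
  "affine_path G p es q \<Longrightarrow> affine_path G q fs r \<Longrightarrow> affine_path G p (es @ fs) r"
proof (induction es arbitrary: p)
  case (Cons e es)
  then show ?case unfolding append_Cons affine_path.simps by blast
qed simp

context affine_graph begin

lemma affine_path_points:
  "affine_path G p es q \<Longrightarrow> p \<in> points G \<and> q \<in> points G"
proof (induction es arbitrary: p)
  case (Cons e es)
  then show ?case using atail_in_points translate_in_points by fastforce
qed simp

lemma affine_path_arcs: "affine_path G p es q \<Longrightarrow> set es \<subseteq> arcs (underlying G)"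
proof (induction es arbitrary: p)
  case (Cons e es)
  then show ?case by (simp only: affine_path.simps set_simps arcs_affine_rep) blast
qed simp

lemma affine_path_translate:
  assumes "w \<in> cone G"
  shows "affine_path G p es q \<Longrightarrow> affine_path G (p +\<^sub>a w) es (q +\<^sub>a w)"
proof (induction es arbitrary: p)
  case (Cons e es)
  then obtain u where u: "e \<in> arcs (underlying G)" "u \<in> cone G" "atail G e +\<^sub>a u = p"
    "affine_path G (ahead G e +\<^sub>a u) es q" by auto
  then have "affine_path G (ahead G e +\<^sub>a (u + w)) es (q +\<^sub>a w)" "atail G e +\<^sub>a (u + w) = p +\<^sub>a w"
    "u + w \<in> cone G"
    using Cons.IH[OF u(4)] assms by (auto simp: translate_translate[symmetric] cone_def)
  with u(1) show ?case by auto
qed (use assms in simp)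

lemma affine_path_rev:
  "affine_path G p es q \<Longrightarrow> affine_path G q (rev (map (einv G) es)) p"
proof (induction es arbitrary: p)
  case (Cons e es)
  then obtain u where u: "e \<in> arcs (underlying G)" "u \<in> cone G" "atail G e +\<^sub>a u = p"
    "affine_path G (ahead G e +\<^sub>a u) es q" by auto
  have "affine_path G (ahead G e +\<^sub>a u) [einv G e] p"
    using u by (auto simp: affine_path_points)
  with Cons.IH[OF u(4)] show ?case by (simp add: affine_path_append)
qed simp

end

text \<open>
  The equivalence relation generated by the translates of the edges in \<open>S\<close> (for \<open>S\<close> closed under
  reversal).  The set of all edges gives conjugacy, and the edges strictly below a point give
  external equivalence.
\<close>

definition conj_via :: "('v, 'e) pre_gbs \<Rightarrow> 'e set \<Rightarrow> 'v point \<Rightarrow> 'v point \<Rightarrow> bool" where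
  "conj_via G S p q \<longleftrightarrow> (\<exists>es. affine_path G p es q \<and> set es \<subseteq> S)"

lemma conj_via_induct [consumes 1, case_names refl step]:
  assumes "conj_via G S p q"
    and "\<And>p. p \<in> points G \<Longrightarrow> R p p"
    and "\<And>e w q. e \<in> arcs (underlying G) \<Longrightarrow> e \<in> S \<Longrightarrow> w \<in> cone G \<Longrightarrow>
       R (ahead G e +\<^sub>a w) q \<Longrightarrow> R (atail G e +\<^sub>a w) q"
  shows "R p q"
proof -
  obtain es where "affine_path G p es q" "set es \<subseteq> S"
    using assms(1) by (auto simp: conj_via_def)
  then show ?thesis
  proof (induction es arbitrary: p)
    case (Cons e es)
    then obtain w where "e \<in> arcs (underlying G)" "e \<in> S" "w \<in> cone G" "atail G e +\<^sub>a w = p"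
      "R (ahead G e +\<^sub>a w) q"
      unfolding affine_path.simps set_simps arcs_affine_rep by blast
    with assms(3)[of e w q] show ?case by blast
  qed (use assms(2) in auto)
qed

lemma conj_via_refl [intro]: "p \<in> points G \<Longrightarrow> conj_via G S p p"
  unfolding conj_via_def by (intro exI[of _ "[]"]) auto

lemma conj_via_trans [trans]: "conj_via G S p q \<Longrightarrow> conj_via G S q r \<Longrightarrow> conj_via G S p r"
  unfolding conj_via_def using affine_path_append[of G p _ q _ r] by (metis Un_least set_append)

context affine_graph begin

lemma conjugate_conv: "conjugate G = conj_via G (arcs (underlying G))"
  unfolding conjugate_def conj_via_def fun_eq_iff using affine_path_arcs by blast

lemma conj_via_points: "conj_via G S p q \<Longrightarrow> p \<in> points G \<and> q \<in> points G"
  unfolding conj_via_def using affine_path_points by blast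

lemma conj_via_translate: "conj_via G S p q \<Longrightarrow> w \<in> cone G \<Longrightarrow> conj_via G S (p +\<^sub>a w) (q +\<^sub>a w)"
  unfolding conj_via_def using affine_path_translate by blast

lemma conj_via_sym:
  assumes "conj_via G S p q" and "einv G ` S \<subseteq> S" shows "conj_via G S q p"
proof -
  obtain es where "affine_path G p es q" "set es \<subseteq> S" using assms by (auto simp: conj_via_def)
  then show ?thesis unfolding conj_via_def using affine_path_rev assms(2)
    by (intro exI[of _ "rev (map (einv G) es)"]) fastforce
qed

lemma conj_via_edge:
  assumes "e \<in> arcs (underlying G)" "e \<in> S" shows "conj_via G S (atail G e) (ahead G e)"
  unfolding conj_via_def using assms by (intro exI[of _ "[e]"]) (auto simp: cone_def intro!: bexI[of _ 0])

lemma conjugate_refl: "p \<in> points G \<Longrightarrow> conjugate G p p"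
  by (auto simp: conjugate_conv)

lemma conjugate_sym: "conjugate G p q \<Longrightarrow> conjugate G q p"
  unfolding conjugate_conv by (rule conj_via_sym) auto

lemma conjugate_trans: "conjugate G p q \<Longrightarrow> conjugate G q r \<Longrightarrow> conjugate G p r"
  unfolding conjugate_conv by (rule conj_via_trans)

lemma conjugate_translate:
  "conjugate G p q \<Longrightarrow> w \<in> cone G \<Longrightarrow> conjugate G (p +\<^sub>a w) (q +\<^sub>a w)"
  unfolding conjugate_conv by (rule conj_via_translate)

lemma conjugate_points: "conjugate G p q \<Longrightarrow> p \<in> points G \<and> q \<in> points G"
  unfolding conjugate_conv by (rule conj_via_points)

lemma conjugate_edge: "e \<in> arcs (underlying G) \<Longrightarrow> conjugate G (atail G e) (ahead G e)"
  unfolding conjugate_conv by (rule conj_via_edge)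

lemma conj_le_points: "conj_le G p q \<Longrightarrow> p \<in> points G \<and> q \<in> points G"
  unfolding conj_le_def using conjugate_points by blast

lemma conj_le_trans:
  assumes "conj_le G p q" "conj_le G q r" shows "conj_le G p r"
proof -
  obtain u where u: "p \<in> points G" "u \<in> cone G" "conjugate G (p +\<^sub>a u) q"
    using assms(1) by (auto simp: conj_le_def point_le_def)
  obtain w where w: "w \<in> cone G" "conjugate G (q +\<^sub>a w) r"
    using assms(2) by (auto simp: conj_le_def point_le_def)
  have "conjugate G (p +\<^sub>a (u + w)) r"
    using conjugate_trans[OF conjugate_translate[OF u(3) w(1)] w(2)] by (simp add: translate_translate)
  moreover have "u + w \<in> cone G" using u w by (simp add: cone_def)
  ultimately show ?thesis using u(1) unfolding conj_le_def point_le_def by blast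
qed

lemma conj_le_if_le:
  assumes "p \<in> points G" "w \<in> cone G" shows "conj_le G p (p +\<^sub>a w)"
  using assms conjugate_refl[of "p +\<^sub>a w"] by (auto simp: conj_le_def point_le_def)

lemma conj_le_if_conjugate: "conjugate G p q \<Longrightarrow> conj_le G p q"
  using conjugate_points[of p q] unfolding conj_le_def point_le_def
  by (metis cone_def translate_0 zero_in_avecs_nonneg)

lemma quasi_conj_if_conjugate: "conjugate G p q \<Longrightarrow> quasi_conj G p q"
  using conj_le_if_conjugate conjugate_sym by (auto simp: quasi_conj_def)

lemma quasi_conj_refl: "p \<in> points G \<Longrightarrow> quasi_conj G p p"
  using conjugate_refl quasi_conj_if_conjugate by blast

lemma quasi_conj_sym: "quasi_conj G p q \<Longrightarrow> quasi_conj G q p"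
  by (auto simp: quasi_conj_def)

lemma quasi_conj_trans: "quasi_conj G p q \<Longrightarrow> quasi_conj G q r \<Longrightarrow> quasi_conj G p r"
  unfolding quasi_conj_def using conj_le_trans by blast

lemma quasi_conj_edge: "e \<in> arcs (underlying G) \<Longrightarrow> quasi_conj G (atail G e) (ahead G e)"
  by (simp add: conjugate_edge quasi_conj_if_conjugate)

lemma equiv_quasi_conj: "equiv (points G) {(p, q). quasi_conj G p q}"
proof (intro equivI refl_onI symI transI)
  show "{(p, q). quasi_conj G p q} \<subseteq> points G \<times> points G"
    unfolding quasi_conj_def using conj_le_points by fast
qed (use quasi_conj_refl quasi_conj_sym quasi_conj_trans in blast)+

lemma quasi_conj_classD:
  assumes "Q \<in> quasi_conj_classes G" "p \<in> Q"
  shows "p \<in> points G" and "q \<in> Q \<longleftrightarrow> quasi_conj G p q"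
  using assms equiv_quasi_conj unfolding quasi_conj_classes_def
  by (auto simp: quotient_def quasi_conj_def dest: conj_le_points intro: conj_le_trans)

lemma quasi_conj_classI: "p \<in> points G \<Longrightarrow> {q. quasi_conj G p q} \<in> quasi_conj_classes G"
  by (auto simp: quasi_conj_classes_def quotient_def)

end

section \<open>The effect of a move on endpoints\<close>

text \<open>
  The common form of the three moves: \<open>elementary P x y x' y'\<close> says that the two edges with endpoint
  pairs \<open>x\<close> and \<open>y\<close> may be replaced by edges with endpoint pairs \<open>x'\<close> and \<open>y'\<close>.  The graph enters only
  through its primes \<open>P\<close>, so a move can be transferred to any graph having two edges with the
  same endpoints.  In a swap, \<open>u\<close>, \<open>u1\<close> and \<open>u2\<close> witness the inequalities between \<open>p\<close>, \<open>q\<close> and the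
  translates of \<open>p\<close>.
\<close>

inductive elementary ::
  "nat set \<Rightarrow> 'v point \<times> 'v point \<Rightarrow> 'v point \<times> 'v point \<Rightarrow>
     'v point \<times> 'v point \<Rightarrow> 'v point \<times> 'v point \<Rightarrow> bool"
  for P where
  slide: "a \<in> avecs_nonneg P \<Longrightarrow> elementary P (p, q) (r, p +\<^sub>a a) (p, q) (r, q +\<^sub>a a)"
| swap: "\<lbrakk>w1 \<in> avecs_nonneg P; w2 \<in> avecs_nonneg P; u \<in> avecs_nonneg P;
     u1 \<in> avecs_nonneg P; u2 \<in> avecs_nonneg P; q = p +\<^sub>a u;
     p +\<^sub>a k1 *\<^sub>a w1 = q +\<^sub>a u1; p +\<^sub>a k2 *\<^sub>a w2 = q +\<^sub>a u2\<rbrakk> \<Longrightarrow>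
     elementary P (p, p +\<^sub>a w1) (q, q +\<^sub>a w2) (q, q +\<^sub>a w1) (p, p +\<^sub>a w2)"
| connection: "\<lbrakk>w \<in> avecs_nonneg P; w1 \<in> avecs_nonneg P; w2 \<in> avecs_nonneg P;
     w1 + w2 = k *\<^sub>a w\<rbrakk> \<Longrightarrow>
     elementary P (q, p +\<^sub>a w1) (p, p +\<^sub>a w) (p, q +\<^sub>a w2) (q, q +\<^sub>a w)"

text \<open>
  A slide is undone by sliding over the reversed edge, a swap by a swap with the two edges exchanged,
  and a connection by a connection with \<open>p\<close> exchanged with \<open>q\<close> and \<open>w1\<close> with \<open>w2\<close>.
\<close>

lemma elementary_inverse:
  assumes "elementary P x y x' y'"
  shows "elementary P (prod.swap x') y' (prod.swap x) y \<or> elementary P x' y' x y \<or>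
     elementary P y' x' y x"
  using assms
proof cases
  case (slide a p q r)
  then show ?thesis using elementary.slide[of a P q p r] by simp
next
  case (swap w1 w2 u u1 u2 q p k1 k2)
  then show ?thesis using elementary.swap[of w2 P w1 u u2 u1 q p k2 k1] by simp
next
  case (connection w w1 w2 k q p)
  then show ?thesis using elementary.connection[of w P w2 w1 k p q] by (simp add: add.commute)
qed

text \<open>
  The new endpoints are joined by paths over the old edges.  For the swapped edge at \<open>p\<close>, run along the
  first loop from \<open>p\<close> up to \<open>q + u1\<close>, use the second loop there, and run back down.  For a connection,
  \<open>q + w2\<close> is joined to \<open>p + w1 + w2\<close>, a multiple of the loop at \<open>p\<close>.
\<close>

lemma elementary_transports:
  assumes "elementary P x y x' y'"
    and eqv: "\<And>p q. R p q \<Longrightarrow> R q p" "\<And>p q r. R p q \<Longrightarrow> R q r \<Longrightarrow> R p r"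
    and transl: "\<And>p q w. R p q \<Longrightarrow> w \<in> avecs_nonneg P \<Longrightarrow> R (p +\<^sub>a w) (q +\<^sub>a w)"
    and refl: "R (fst x) (fst x)" "R (fst y) (fst y)"
    and x: "R (fst x) (snd x)" and y: "R (fst y) (snd y)"
  shows "R (fst x') (snd x') \<and> R (fst y') (snd y')"
proof -
  \<comment> \<open>A loop at a point can be iterated, because each turn translates the previous ones.\<close>
  have loop: "R p (p +\<^sub>a k *\<^sub>a w)" if "R p p" "R p (p +\<^sub>a w)" "w \<in> avecs_nonneg P" for p k w
  proof (induction k)
    case (Suc k)
    have "R (p +\<^sub>a k *\<^sub>a w) (p +\<^sub>a w +\<^sub>a k *\<^sub>a w)"
      using transl[OF that(2), of "k *\<^sub>a w"] that(3) by simp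
    with Suc eqv(2) show ?case by (simp add: translate_translate add.commute)
  qed (use that in simp)
  from assms(1) show ?thesis
  proof cases
    case (slide a p q r)
    then have "R (p +\<^sub>a a) (q +\<^sub>a a)" using x transl by simp
    with slide x y eqv(2) show ?thesis by auto
  next
    case (swap w1 w2 u u1 u2 q p k1 k2)
    have p1: "R p (p +\<^sub>a w1)" and q2: "R q (q +\<^sub>a w2)" and pp: "R p p"
      using x y refl swap by auto
    have "R q (q +\<^sub>a w1)"
      using transl[OF p1 swap(7)] swap(10) by (simp add: translate_commute)
    moreover have "R p (p +\<^sub>a w2)"
    proof -
      have a: "R p (q +\<^sub>a u1)"
        using loop[OF pp p1 swap(5), of k1] swap by simp
      have b: "R (q +\<^sub>a u1) (q +\<^sub>a u1 +\<^sub>a w2)"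
        using transl[OF q2 swap(8)] by (simp add: translate_commute)
      have "R (p +\<^sub>a w2) (q +\<^sub>a u1 +\<^sub>a w2)"
        using transl[OF a] swap by simp
      with a b eqv show ?thesis by blast
    qed
    ultimately show ?thesis using swap by simp
  next
    case (connection w w1 w2 k q p)
    have q1: "R q (p +\<^sub>a w1)" and p1: "R p (p +\<^sub>a w)" and pp: "R p p"
      using x y refl connection by auto
    have "R (q +\<^sub>a w2) (p +\<^sub>a k *\<^sub>a w)"
      using transl[OF q1 connection(7)] connection(8) by (simp add: translate_translate)
    with loop[OF pp p1 connection(5), of k] eqv have "R p (q +\<^sub>a w2)" by blast
    moreover have "R q (q +\<^sub>a w)"
    proof -
      have "R (p +\<^sub>a w1) (p +\<^sub>a w1 +\<^sub>a w)"
        using transl[OF p1 connection(6)] by (simp add: translate_commute)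
      with q1 transl[OF q1 connection(5)] eqv show ?thesis by blast
    qed
    ultimately show ?thesis using connection by simp
  qed
qed

text \<open>
  The total set of primes in the four endpoints does not change: each of the vectors \<open>a\<close>, \<open>w1\<close>, \<open>w2\<close>, \<open>w\<close>
  is visible in the endpoints before and after the move, since nonnegative vectors do not cancel.
\<close>

lemma elementary_supports:
  assumes "elementary P x y x' y'"
    and "snd (fst x) \<in> avecs_nonneg P" "snd (snd x) \<in> avecs_nonneg P"
    and "snd (fst y) \<in> avecs_nonneg P" "snd (snd y) \<in> avecs_nonneg P"
  shows "snd (fst x') \<in> avecs_nonneg P" "snd (snd x') \<in> avecs_nonneg P"
    and "snd (fst y') \<in> avecs_nonneg P" "snd (snd y') \<in> avecs_nonneg P"
    and "support (snd (fst x')) \<union> support (snd (snd x')) \<union>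
         (support (snd (fst y')) \<union> support (snd (snd y'))) =
         support (snd (fst x)) \<union> support (snd (snd x)) \<union>
         (support (snd (fst y)) \<union> support (snd (snd y)))"
proof -
  note [simp] = support_add_nonneg[where P = P] and [simp del] = snd_add
  have "snd (fst x') \<in> avecs_nonneg P \<and> snd (snd x') \<in> avecs_nonneg P \<and>
    snd (fst y') \<in> avecs_nonneg P \<and> snd (snd y') \<in> avecs_nonneg P \<and>
    support (snd (fst x')) \<union> support (snd (snd x')) \<union>
         (support (snd (fst y')) \<union> support (snd (snd y'))) =
         support (snd (fst x)) \<union> support (snd (snd x)) \<union>
         (support (snd (fst y)) \<union> support (snd (snd y)))"
    using assms(1)
  proof cases
    case (slide a p q r)
    then show ?thesis using assms(2-) by auto
  next
    case (swap w1 w2 u u1 u2 q p k1 k2)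
    have p: "snd p \<in> avecs_nonneg P" using assms(2) swap by simp
    then show ?thesis using swap by auto
  next
    case (connection w w1 w2 k q p)
    have "snd p \<in> avecs_nonneg P" "snd q \<in> avecs_nonneg P" using assms connection by simp_all
    moreover have "support w1 \<union> support w2 \<subseteq> support w"
      using support_nmult_subset[of w P k] connection(5,6,7)
      by (simp flip: connection(8))
    ultimately show ?thesis using connection by auto
  qed
  then show "snd (fst x') \<in> avecs_nonneg P" "snd (snd x') \<in> avecs_nonneg P"
    and "snd (fst y') \<in> avecs_nonneg P" "snd (snd y') \<in> avecs_nonneg P"
    and "support (snd (fst x')) \<union> support (snd (snd x')) \<union>
         (support (snd (fst y')) \<union> support (snd (snd y'))) =
         support (snd (fst x)) \<union> support (snd (snd x)) \<union>
         (support (snd (fst y)) \<union> support (snd (snd y)))" by blast+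
qed


lemma elementary_fst:
  assumes "elementary P x y x' y'"
  shows "{fst (fst x'), fst (snd x'), fst (fst y'), fst (snd y')} \<subseteq>
    {fst (fst x), fst (snd x), fst (fst y), fst (snd y)}"
  using assms by cases auto

context affine_graph begin

lemma conjugate_add_nmult:
  assumes "conjugate G p (p +\<^sub>a w)" "w \<in> cone G"
  shows "conjugate G p (p +\<^sub>a k *\<^sub>a w)"
proof (induction k)
  case 0
  show ?case using assms conjugate_points conjugate_refl by simp
next
  case (Suc k)
  have "conjugate G (p +\<^sub>a k *\<^sub>a w) (p +\<^sub>a w +\<^sub>a k *\<^sub>a w)"
    using conjugate_translate[OF assms(1)] assms(2) by (simp add: cone_def)
  with Suc conjugate_trans show ?case by (simp add: translate_translate add.commute)
qed

text \<open>
  Either the move is a slide, whose fixed edge lies weakly below the moving one, or both edges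
  belong to one quasi-conjugacy class, which the move respects.  For the loops of a swap this holds
  because \<open>q\<close> lies between \<open>p\<close> and a conjugate of \<open>p\<close>; for a connection because \<open>q\<close> is conjugate to
  \<open>p + w1\<close>, which lies between \<open>p\<close> and \<open>p + k w\<close>.
\<close>

lemma elementary_classes:
  assumes "elementary (primes_of G) x y x' y'"
    and x: "conjugate G (fst x) (snd x)" and y: "conjugate G (fst y) (snd y)"
  obtains (slide) a where "x' = x" "fst y' = fst y" "conj_le G (fst x) (fst y)" "a \<in> cone G"
      "snd y = fst x +\<^sub>a a" "snd y' = snd x +\<^sub>a a"
  | (loops) "quasi_conj G (fst x) (fst y)" "quasi_conj G (fst x) (fst x')"
      "quasi_conj G (fst y) (fst y')"
  using assms(1)
proof cases
  case (slide a p q r)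
  have "conj_le G p (p +\<^sub>a a)"
    using conj_le_if_le conjugate_points[OF x] slide by (simp add: cone_def)
  moreover have "conj_le G (p +\<^sub>a a) r"
    using conj_le_if_conjugate[OF conjugate_sym[OF y]] slide by simp
  ultimately have "conj_le G p r" by (rule conj_le_trans)
  then show ?thesis using slide that(1) by (simp add: cone_def)
next
  case (swap w1 w2 u u1 u2 q p k1 k2)
  have pts: "p \<in> points G" "q \<in> points G"
    using conjugate_points x y swap by auto
  have "conj_le G p q"
    using conj_le_if_le[of p u] pts swap by (simp add: cone_def)
  moreover have "conj_le G q p"
  proof -
    have "conj_le G q (p +\<^sub>a k1 *\<^sub>a w1)"
      using conj_le_if_le[of q u1] pts swap by (simp add: cone_def)
    moreover have "conj_le G (p +\<^sub>a k1 *\<^sub>a w1) p"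
      using conj_le_if_conjugate[OF conjugate_sym[OF conjugate_add_nmult[of p w1 k1]]] x swap
      by (simp add: cone_def)
    ultimately show ?thesis using conj_le_trans by blast
  qed
  ultimately have "quasi_conj G p q" by (simp add: quasi_conj_def)
  then show ?thesis using that(2) swap quasi_conj_sym by simp
next
  case (connection w w1 w2 k q p)
  have pts: "p \<in> points G" "q \<in> points G"
    using conjugate_points x y connection by auto
  have "conj_le G p (p +\<^sub>a w1)"
    using conj_le_if_le pts connection by (simp add: cone_def)
  moreover have "conj_le G (p +\<^sub>a w1) q"
    using conj_le_if_conjugate[OF conjugate_sym[OF x]] connection by simp
  ultimately have "conj_le G p q" by (rule conj_le_trans)
  moreover have "conj_le G q p"
  proof -
    have "conj_le G q (p +\<^sub>a w1)" using x connection conj_le_if_conjugate by simp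
    moreover have "conj_le G (p +\<^sub>a w1) (p +\<^sub>a k *\<^sub>a w)"
      using conj_le_if_le[of "p +\<^sub>a w1" w2] pts connection(5-)
      by (simp add: cone_def translate_translate)
    moreover have "conj_le G (p +\<^sub>a k *\<^sub>a w) p"
      using conj_le_if_conjugate[OF conjugate_sym[OF conjugate_add_nmult[of p w k]]] y connection
      by (simp add: cone_def)
    ultimately show ?thesis using conj_le_trans by blast
  qed
  ultimately have "quasi_conj G p q" by (simp add: quasi_conj_def)
  then show ?thesis using that(2) connection quasi_conj_sym by simp
qed

end

lemma (in affine_graph) elementary_conj_via:
  assumes el: "elementary (primes_of G) x y x' y'" and S: "einv G ` S \<subseteq> S"
    and x: "conj_via G S (fst x) (snd x)" and y: "conj_via G S (fst y) (snd y)"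
  shows "conj_via G S (fst x') (snd x')" "conj_via G S (fst y') (snd y')"
proof -
  have "conj_via G S (fst x') (snd x') \<and> conj_via G S (fst y') (snd y')"
  proof (rule elementary_transports[OF el])
    show "conj_via G S (fst x) (fst x)" "conj_via G S (fst y) (fst y)"
      using conj_via_points x y by blast+
    show "conj_via G S (p +\<^sub>a w) (q +\<^sub>a w)"
      if "conj_via G S p q" "w \<in> avecs_nonneg (primes_of G)" for p q w
      using conj_via_translate[OF that(1)] that(2) by (simp add: cone_def)
  qed (use conj_via_sym[OF _ S] conj_via_trans x y in blast)+
  then show "conj_via G S (fst x') (snd x')" "conj_via G S (fst y') (snd y')" by blast+
qed

section \<open>Invariance of primes and conjugacy\<close>

text \<open>
  A move between graphs that are not yet known to be connected.
\<close>

definition premove :: "('v, 'e) pre_gbs \<Rightarrow> 'e \<Rightarrow> 'e \<Rightarrow> ('v, 'e) pre_gbs \<Rightarrow> bool" where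
  "premove G e f G' \<longleftrightarrow> affine_graph G \<and> affine_graph G' \<and> distinct_edges G e f \<and>
     verts (underlying G') = verts (underlying G) \<and>
     arcs (underlying G') = arcs (underlying G) \<and> einv G' = einv G \<and>
     (\<forall>x \<in> arcs (underlying G) - ({e, f} \<union> einv G ` {e, f}). ends G' x = ends G x) \<and>
     elementary (primes_of G) (ends G e) (ends G f) (ends G' e) (ends G' f)"

lemma move_iff_premove:
  "slide G e f G' \<or> swap G e f G' \<or> connection G e f G' \<longleftrightarrow>
     premove G e f G' \<and> gbs_graph G \<and> gbs_graph G'"
  (is "?L \<longleftrightarrow> ?R")
proof
  assume ?L
  then show ?R
  proof (elim disjE)
    assume s: "slide G e f G'"
    then have m: "distinct_edges G e f" "modifies G {f} G'" by (auto simp: slide_def)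
    then interpret affine_graph G by (simp add: modifies_def gbs_graphD)
    have "e \<noteq> einv G f" using m(1) by (auto simp: distinct_edges_def)
    with m have "ends G' e = ends G e"
      unfolding modifies_def distinct_edges_def by auto
    then have "elementary (primes_of G) (ends G e) (ends G f) (ends G' e) (ends G' f)"
      using s elementary.slide unfolding slide_def cone_def by metis
    with m show ?R by (auto simp: premove_def modifies_def gbs_graphD)
  next
    assume s: "swap G e f G'"
    then have m: "distinct_edges G e f" "modifies G {e, f} G'" by (auto simp: swap_def)
    have "elementary (primes_of G) (ends G e) (ends G f) (ends G' e) (ends G' f)"
      using s elementary.swap unfolding swap_def cone_def point_le_def by metis
    with m show ?R by (simp add: premove_def modifies_def gbs_graphD)
  next
    assume s: "connection G e f G'"
    then have m: "distinct_edges G e f" "modifies G {e, f} G'" by (auto simp: connection_def)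
    have "elementary (primes_of G) (ends G e) (ends G f) (ends G' e) (ends G' f)"
      using s elementary.connection unfolding connection_def cone_def by metis
    with m show ?R by (simp add: premove_def modifies_def gbs_graphD)
  qed
next
  assume R: ?R
  then have m: "distinct_edges G e f" "modifies G {e, f} G'"
    and el: "elementary (primes_of G) (ends G e) (ends G f) (ends G' e) (ends G' f)"
    by (auto simp: premove_def modifies_def)
  from el show ?L
  proof cases
    case (slide a p q r)
    interpret affine_graph G using R by (simp add: premove_def)
    have "ends G' (einv G e) = ends G (einv G e)"
      using slide R affine_graph.atail_einv[of G' e] ahead_einv[of G' e]
      by (auto simp: ends_eq premove_def)
    with slide m have "modifies G {f} G'" by (auto simp: modifies_def)
    with slide m show ?thesis unfolding slide_def cone_def by metis
  next
    case (swap w1 w2 u u1 u2 q p k1 k2)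
    then have "point_le G p q" "point_le G q (p +\<^sub>a k1 *\<^sub>a w1)" "point_le G q (p +\<^sub>a k2 *\<^sub>a w2)"
      unfolding point_le_def cone_def by auto
    with swap m show ?thesis unfolding swap_def cone_def by metis
  next
    case (connection w w1 w2 k q p)
    with m show ?thesis unfolding connection_def cone_def by metis
  qed
qed

lemma premove_primes_of:
  assumes "premove G e f G'"
  shows "primes_of G' = primes_of G"
proof -
  interpret G: affine_graph G using assms by (simp add: premove_def)
  interpret G': affine_graph G' using assms by (simp add: premove_def)
  define X where "X = arcs (underlying G) - ({e, f} \<union> einv G ` {e, f})"
  have ef: "e \<in> arcs (underlying G)" "f \<in> arcs (underlying G)"
    using assms by (auto simp: premove_def distinct_edges_def)
  then have arcs: "arcs (underlying G) = X \<union> ({e, f} \<union> einv G ` {e, f})"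
    by (auto simp: X_def)
  have same: "ahead G' x = ahead G x" if "x \<in> X" for x
    using assms that by (auto simp: premove_def ends_eq X_def)
  have cone: "snd (ahead G x) \<in> avecs_nonneg (primes_of G)" "snd (atail G x) \<in> avecs_nonneg (primes_of G)"
    if "x \<in> arcs (underlying G)" for x
    using G.ahead_in_points[OF that] G.atail_in_points[OF that]
    by (simp_all add: points_def mem_Times_iff cone_def)
  have einv: "einv G' = einv G" and arcs': "arcs (underlying G') = arcs (underlying G)"
    and el: "elementary (primes_of G) (ends G e) (ends G f) (ends G' e) (ends G' f)"
    using assms by (auto simp: premove_def)
  have "primes_of G' = (\<Union>x \<in> X. support (snd (ahead G x))) \<union>
      (support (snd (atail G' e)) \<union> support (snd (ahead G' e)) \<union>
      (support (snd (atail G' f)) \<union> support (snd (ahead G' f))))"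
    unfolding G'.primes_of_conv arcs' arcs using same ahead_einv[of G' e] ahead_einv[of G' f]
    by (simp add: einv) blast
  also have "\<dots> = (\<Union>x \<in> X. support (snd (ahead G x))) \<union>
      (support (snd (atail G e)) \<union> support (snd (ahead G e)) \<union>
      (support (snd (atail G f)) \<union> support (snd (ahead G f))))"
    using elementary_supports(5)[OF el] cone ef by (simp add: ends_eq)
  also have "\<dots> = primes_of G"
    unfolding G.primes_of_conv arcs by simp blast
  finally show ?thesis .
qed

text \<open>
  By translation invariance it suffices to connect the endpoints of each single edge.
\<close>

lemma conj_via_transfer:
  assumes "conj_via G S p q" and "affine_graph K" and "points G = points K" "cone G = cone K"
    and edge: "\<And>e. e \<in> arcs (underlying G) \<Longrightarrow> e \<in> S \<Longrightarrow> conj_via K S (atail G e) (ahead G e)"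
  shows "conj_via K S p q"
  using assms(1)
proof (induction rule: conj_via_induct)
  case (refl p)
  then show ?case using assms(3) by auto
next
  case (step e w q)
  then have "conj_via K S (atail G e +\<^sub>a w) (ahead G e +\<^sub>a w)"
    using affine_graph.conj_via_translate[OF assms(2)] edge assms(4) by simp
  with step show ?case using conj_via_trans by blast
qed

text \<open>
  A move does not change the relation generated by \<open>S\<close> if \<open>S\<close> contains both edges, or if no edge
  of \<open>S\<close> is changed.  The second case is needed when an edge outside \<open>S\<close> slides over an edge of \<open>S\<close>.
\<close>

lemma premove_conj_via:
  assumes pm: "premove G e f G'" and S: "einv G ` S \<subseteq> S"
    and cases: "e \<in> S \<and> f \<in> S \<or> f \<notin> S \<and> (e \<in> S \<longrightarrow> ends G' e = ends G e)"
  shows "conj_via G' S p q \<longleftrightarrow> conj_via G S p q"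
proof -
  interpret G: affine_graph G using pm by (simp add: premove_def)
  interpret G': affine_graph G' using pm by (simp add: premove_def)
  have fr: "einv G' = einv G" "arcs (underlying G') = arcs (underlying G)"
      "verts (underlying G') = verts (underlying G)"
    and off: "\<And>x. x \<in> arcs (underlying G) \<Longrightarrow> x \<notin> {e, f, einv G e, einv G f} \<Longrightarrow> ends G' x = ends G x"
    and el: "elementary (primes_of G) (ends G e) (ends G f) (ends G' e) (ends G' f)"
    and ef: "e \<in> arcs (underlying G)" "f \<in> arcs (underlying G)"
    using pm by (auto simp: premove_def distinct_edges_def)
  have cone: "cone G' = cone G" by (simp add: cone_def premove_primes_of[OF pm])
  then have points: "points G' = points G" by (simp add: points_def fr)
  have S': "einv G' ` S \<subseteq> S" using S fr by simp
  \<comment> \<open>The two graphs play symmetric roles, as the inverse of a move has the same form.\<close>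
  have transfer: "conj_via B S p q"
    if "conj_via A S p q" "affine_graph A" "affine_graph B"
      and same: "points A = points B" "cone A = cone B"
      and eA: "arcs (underlying A) = arcs (underlying G)" "arcs (underlying B) = arcs (underlying G)"
      "einv A = einv G" "einv B = einv G"
      and off: "\<And>x. x \<in> arcs (underlying G) \<Longrightarrow> x \<notin> {e, f, einv G e, einv G f} \<Longrightarrow> ends A x = ends B x"
      and both: "e \<in> S \<Longrightarrow> f \<in> S \<Longrightarrow> conj_via B S (atail A e) (ahead A e)"
        "e \<in> S \<Longrightarrow> f \<in> S \<Longrightarrow> conj_via B S (atail A f) (ahead A f)"
      and ends_e: "f \<notin> S \<Longrightarrow> e \<in> S \<Longrightarrow> ends A e = ends B e"
    for A B
  proof -
    interpret A: affine_graph A by fact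
    interpret B: affine_graph B by fact
    have SB: "einv B ` S \<subseteq> S" using S eA by simp
    have rev: "conj_via B S (atail A (einv G x)) (ahead A (einv G x))"
      if "conj_via B S (atail A x) (ahead A x)" for x
      using B.conj_via_sym[OF that SB] A.atail_einv[of x] ahead_einv[of A x] eA by simp
    have own: "conj_via B S (atail A x) (ahead A x)"
      if "x \<in> arcs (underlying G)" "x \<in> S" "ends A x = ends B x" for x
      using that B.conj_via_edge[of x S] eA by (simp add: ends_eq)
    have inS: "einv G x \<in> S \<longleftrightarrow> x \<in> S" for x
      using S by (metis G.arev_arev image_subset_iff)
    show ?thesis
    proof (rule conj_via_transfer[OF that(1)])
      fix x assume x: "x \<in> arcs (underlying A)" "x \<in> S"
      show "conj_via B S (atail A x) (ahead A x)"
      proof (cases "x \<in> {e, f, einv G e, einv G f}")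
        case False
        then show ?thesis using own off x eA by simp
      next
        case True
        show ?thesis
        proof (cases "e \<in> S \<and> f \<in> S")
          case True
          with \<open>x \<in> {e, f, einv G e, einv G f}\<close> both rev show ?thesis by blast
        next
          case False
          with cases have "f \<notin> S" by blast
          with True x inS have "e \<in> S" "x = e \<or> x = einv G e" by auto
          with own[of e] rev[of e] ends_e \<open>f \<notin> S\<close> ef show ?thesis by blast
        qed
      qed
    qed (fact B.affine_graph_axioms same)+
  qed
  have new: "conj_via G S (atail G' e) (ahead G' e)" "conj_via G S (atail G' f) (ahead G' f)"
    if "e \<in> S" "f \<in> S"
    using G.elementary_conj_via[OF el S] G.conj_via_edge[OF ef(1) that(1)]
      G.conj_via_edge[OF ef(2) that(2)] by (simp_all add: ends_eq)
  have old: "conj_via G' S (atail G e) (ahead G e)" "conj_via G' S (atail G f) (ahead G f)"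
    if "e \<in> S" "f \<in> S"
  proof -
    have e': "conj_via G' S (atail G' e) (ahead G' e)" and f': "conj_via G' S (atail G' f) (ahead G' f)"
      using G'.conj_via_edge that ef fr by simp_all
    note T = G'.elementary_conj_via[OF _ S', unfolded premove_primes_of[OF pm]]
    have "conj_via G' S (atail G e) (ahead G e) \<and> conj_via G' S (atail G f) (ahead G f)"
      using elementary_inverse[OF el]
    proof (elim disjE)
      assume "elementary (primes_of G) (prod.swap (ends G' e)) (ends G' f) (prod.swap (ends G e)) (ends G f)"
      from T[OF this] G'.conj_via_sym[OF e' S'] f' show ?thesis
        using G'.conj_via_sym[OF _ S', of "ahead G e" "atail G e"] by (simp add: ends_eq)
    next
      assume "elementary (primes_of G) (ends G' e) (ends G' f) (ends G e) (ends G f)"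
      from T[OF this] e' f' show ?thesis by (simp add: ends_eq)
    next
      assume "elementary (primes_of G) (ends G' f) (ends G' e) (ends G f) (ends G e)"
      from T[OF this] e' f' show ?thesis by (simp add: ends_eq)
    qed
    then show "conj_via G' S (atail G e) (ahead G e)" "conj_via G' S (atail G f) (ahead G f)" by blast+
  qed
  have ends_e: "f \<notin> S \<Longrightarrow> e \<in> S \<Longrightarrow> ends G' e = ends G e" using cases by blast
  show ?thesis
  proof
    assume "conj_via G' S p q"
    then show "conj_via G S p q"
      using G'.affine_graph_axioms G.affine_graph_axioms points cone fr(2) refl fr(1) refl off new ends_e
      by (rule transfer)
  next
    assume "conj_via G S p q"
    then show "conj_via G' S p q"
      using G.affine_graph_axioms G'.affine_graph_axioms points[symmetric] cone[symmetric]
        refl fr(2) refl fr(1) off[symmetric] old ends_e[symmetric]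
      by (rule transfer)
  qed
qed

section \<open>Realising moves by graphs\<close>

text \<open>
  The graph with the vertices and edges of \<open>G\<close> whose edges end in the prescribed points \<open>h\<close>; initial
  points are prescribed through the reversed edges.
\<close>

definition realise :: "('v, 'e) pre_gbs \<Rightarrow> ('e \<Rightarrow> 'v point) \<Rightarrow> ('v, 'e) pre_gbs" where
  "realise G h = \<lparr>underlying = \<lparr>verts = verts (underlying G), arcs = arcs (underlying G),
       tail = (\<lambda>e. fst (h (einv G e))), head = (\<lambda>e. fst (h e))\<rparr>,
     einv = einv G, label = (\<lambda>e. int_of_avec (snd (h e)))\<rparr>"

lemma realise_simps [simp]:
  "verts (underlying (realise G h)) = verts (underlying G)"
  "arcs (underlying (realise G h)) = arcs (underlying G)"
  "einv (realise G h) = einv G"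
  by (simp_all add: realise_def)

lemma (in affine_graph) realise:
  assumes h: "\<And>e. e \<in> arcs (underlying G) \<Longrightarrow> h e \<in> points G"
  shows "affine_graph (realise G h)"
    and "e \<in> arcs (underlying G) \<Longrightarrow> ahead (realise G h) e = h e"
proof -
  have h': "fst (h e) \<in> verts (underlying G)" "snd (h e) \<in> avecs_nonneg (primes_of G)"
    if "e \<in> arcs (underlying G)" for e
    using h[OF that] by (simp_all add: points_def mem_Times_iff cone_def)
  have nz: "int_of_avec (snd (h e)) \<noteq> 0" "avec_of_int (int_of_avec (snd (h e))) = snd (h e)"
    if "e \<in> arcs (underlying G)" for e
    using avec_of_int_of_avec[OF h'(2)[OF that]] prime_if_primes_of by blast+
  show "affine_graph (realise G h)"
  proof unfold_locales
    show "a \<in> arcs (underlying (realise G h)) \<longleftrightarrow> einv (realise G h) a \<noteq> a" for a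
      by (simp add: arev_dom)
  qed (use h'(1) nz(1) in \<open>simp_all add: realise_def\<close>)
  show "ahead (realise G h) e = h e" if "e \<in> arcs (underlying G)"
    using nz(2)[OF that] by (intro prod_eqI) (simp_all only: fst_ahead snd_ahead, simp_all add: realise_def)
qed

lemma (in affine_graph) affine_path_reachable:
  "affine_path G p es q \<Longrightarrow> fst p \<rightarrow>\<^sup>*\<^bsub>underlying G\<^esub> fst q"
proof (induction es arbitrary: p)
  case Nil
  then show ?case by (auto simp: points_def mem_Times_iff)
next
  case (Cons e es)
  then obtain w where e: "e \<in> arcs (underlying G)" "atail G e +\<^sub>a w = p"
    and path: "affine_path G (ahead G e +\<^sub>a w) es q"
    unfolding affine_path.simps arcs_affine_rep by blast
  from e have "fst p = tail (underlying G) e" using fst_atail by auto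
  with e(1) have "fst p \<rightarrow>\<^bsub>underlying G\<^esub> head (underlying G) e"
    by (metis in_arcs_imp_in_arcs_ends)
  with Cons.IH[OF path] show ?case using adj_reachable_trans by (simp add: fst_ahead)
qed

text \<open>
  An affine path projects to a walk in the underlying graph.  So a graph is connected if it conjugates
  the endpoints of all edges of some connected graph on the same vertices.
\<close>

lemma connected_if_conjugate:
  assumes G: "gbs_graph G" and "affine_graph K"
    and verts: "verts (underlying K) = verts (underlying G)"
    and conj: "\<And>e. e \<in> arcs (underlying G) \<Longrightarrow> conjugate K (atail G e) (ahead G e)"
  shows "connected (underlying K)"
proof -
  interpret G: gbs_graph G by fact
  interpret AG: affine_graph G using G by (rule gbs_graphD)
  interpret K: affine_graph K by fact
  have str: "strongly_connected (underlying G)"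
    using G.symmetric_connected_imp_strongly_connected[OF G.sym_arcs G.underlying_connected] .
  have reach: "u \<rightarrow>\<^sup>*\<^bsub>underlying K\<^esub> v" if "u \<rightarrow>\<^sup>*\<^bsub>underlying G\<^esub> v" for u v
    using that
  proof (induction rule: G.converse_reachable_induct)
    case base
    then show ?case using verts by auto
  next
    case (step x y)
    then obtain e where e: "e \<in> arcs (underlying G)" "tail (underlying G) e = x" "head (underlying G) e = y"
      by auto
    then obtain es where "affine_path K (atail G e) es (ahead G e)"
      using conj[of e] by (auto simp: conjugate_def)
    from K.affine_path_reachable[OF this] have "x \<rightarrow>\<^sup>*\<^bsub>underlying K\<^esub> y"
      using e AG.fst_atail by (simp add: fst_ahead)
    with step show ?case using K.reachable_trans by blast
  qed
  show ?thesis
    using str reach verts unfolding connected_def strongly_connected_def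
    by (simp add: K.reachable_mk_symmetric_eq[OF K.sym_arcs])
qed

lemma premove_gbs_graph:
  assumes G: "gbs_graph G" and pm: "premove G e f G'"
  shows "gbs_graph G'"
proof -
  interpret G: affine_graph G using G by (rule gbs_graphD)
  have ef: "e \<in> arcs (underlying G)" "f \<in> arcs (underlying G)"
    and fr: "verts (underlying G') = verts (underlying G)"
      "arcs (underlying G') = arcs (underlying G)" "affine_graph G'"
    using pm by (auto simp: premove_def distinct_edges_def)
  have "conjugate G' p q \<longleftrightarrow> conjugate G p q" for p q
    using premove_conj_via[OF pm, of "arcs (underlying G)" p q] ef fr
    by (simp add: G.conjugate_conv affine_graph.conjugate_conv image_subset_iff)
  then have "connected (underlying G')"
    using connected_if_conjugate[OF G fr(3) fr(1)] G.conjugate_edge by simp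
  with fr(3) show ?thesis by (simp add: gbs_graph_iff)
qed

text \<open>
  Only the two pairs of endpoints have to be checked to perform a move: the new endpoints are points of
  the same affine representation, and connectedness is inherited because conjugacy does not change.
\<close>

lemma move_exists:
  assumes G: "gbs_graph G" and d: "distinct_edges G e f"
    and el: "elementary (primes_of G) (ends G e) (ends G f) x y"
  obtains G' where "premove G e f G'" "gbs_graph G'" "ends G' e = x" "ends G' f = y"
proof -
  interpret G: affine_graph G using G by (rule gbs_graphD)
  have ef: "e \<in> arcs (underlying G)" "f \<in> arcs (underlying G)"
    and ne: "f \<noteq> e" "f \<noteq> einv G e" "einv G f \<noteq> e" "einv G f \<noteq> einv G e" "einv G e \<noteq> e" "einv G f \<noteq> f"
    using d G.arev_neq by (auto simp: distinct_edges_def G.arev_eq_iff)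
  define h where "h = (ahead G)(e := snd x, einv G e := fst x, f := snd y, einv G f := fst y)"
  have pts: "atail G e \<in> points G" "ahead G e \<in> points G" "atail G f \<in> points G" "ahead G f \<in> points G"
    using ef by auto
  have "snd (fst x) \<in> cone G" "snd (snd x) \<in> cone G" "snd (fst y) \<in> cone G" "snd (snd y) \<in> cone G"
    using elementary_supports(1-4)[OF el, unfolded ends_eq fst_conv snd_conv] pts
    by (simp_all only: points_def cone_def mem_Times_iff)
  moreover have "{fst (fst x), fst (snd x), fst (fst y), fst (snd y)} \<subseteq> verts (underlying G)"
  proof (rule subset_trans[OF elementary_fst[OF el]])
    show "{fst (fst (ends G e)), fst (snd (ends G e)), fst (fst (ends G f)), fst (snd (ends G f))}
        \<subseteq> verts (underlying G)"
      using pts by (simp add: points_def mem_Times_iff ends_eq)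
  qed
  ultimately have "fst x \<in> points G" "snd x \<in> points G" "fst y \<in> points G" "snd y \<in> points G"
    by (simp_all add: points_def mem_Times_iff)
  then have h: "h a \<in> points G" if "a \<in> arcs (underlying G)" for a
    using that by (simp add: h_def)
  define G' where "G' = realise G h"
  have A: "affine_graph G'" and hd: "ahead G' a = h a" if "a \<in> arcs (underlying G)" for a
    using G.realise[of h] h that by (auto simp: G'_def)
  have fr: "verts (underlying G') = verts (underlying G)"
      "arcs (underlying G') = arcs (underlying G)" "einv G' = einv G"
    by (simp_all add: G'_def)
  have tl: "atail G' a = h (einv G a)" if "a \<in> arcs (underlying G)" for a
    using hd[of "einv G a"] ahead_einv[of G' a] that by (simp add: fr)
  have e: "ends G' e = x" "ends G' f = y"
    using ef ne by (simp_all add: ends_eq hd tl h_def)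
  have off: "ends G' a = ends G a" if "a \<in> arcs (underlying G) - ({e, f} \<union> einv G ` {e, f})" for a
  proof -
    have "einv G a \<noteq> e" "einv G a \<noteq> f" using that by auto
    with that show ?thesis by (simp add: ends_eq hd tl h_def G.arev_eq_iff)
  qed
  have "affine_graph G'" using A ef(1) by blast
  with e off d el have pm: "premove G e f G'"
    by (simp add: premove_def fr G.affine_graph_axioms)
  with that premove_gbs_graph[OF G pm] e show ?thesis by blast
qed

text \<open>
  An edge can slide along an affine path that starts at its endpoint and avoids the edge itself:
  each edge of the path contributes one slide and is not affected by the slides before it.
\<close>

lemma path_slides:
  assumes "gbs_graph G" "f \<in> arcs (underlying G)" "affine_path G (ahead G f) es q"
    and "f \<notin> set es" "einv G f \<notin> set es"
  shows "\<exists>G'. gbs_move\<^sup>*\<^sup>* G G' \<and> modifies G {f} G' \<and> ends G' f = (atail G f, q)"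
  using assms
proof (induction es arbitrary: G)
  case Nil
  then have "ends G f = (atail G f, q)" "modifies G {f} G" by (auto simp: ends_eq modifies_def)
  then show ?case by blast
next
  case (Cons e es)
  interpret G: affine_graph G using Cons.prems(1) by (rule gbs_graphD)
  obtain w where e: "e \<in> arcs (underlying G)" and w: "w \<in> cone G" "atail G e +\<^sub>a w = ahead G f"
    and path: "affine_path G (ahead G e +\<^sub>a w) es q"
    using Cons.prems(3) unfolding affine_path.simps arcs_affine_rep by blast
  have d: "distinct_edges G e f"
    using Cons.prems e by (auto simp: distinct_edges_def)
  have "elementary (primes_of G) (ends G e) (ends G f) (ends G e) (atail G f, ahead G e +\<^sub>a w)"
    using elementary.slide[of w "primes_of G" "atail G e" "ahead G e" "atail G f"] w
    by (simp add: ends_eq cone_def)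
  from move_exists[OF Cons.prems(1) d this]
  obtain K where K: "premove G e f K" "gbs_graph K" "ends K e = ends G e"
    "ends K f = (atail G f, ahead G e +\<^sub>a w)" by blast
  interpret K: affine_graph K using K(2) by (rule gbs_graphD)
  have fr: "verts (underlying K) = verts (underlying G)" "arcs (underlying K) = arcs (underlying G)"
    "einv K = einv G"
    and offK: "\<And>x. x \<in> arcs (underlying G) - ({e, f} \<union> einv G ` {e, f}) \<Longrightarrow> ends K x = ends G x"
    using K(1) by (auto simp: premove_def)
  have "ends K (einv G e) = ends G (einv G e)"
    using K(3) K.atail_einv[of e] ahead_einv[of K e] by (simp add: ends_eq fr)
  with offK K(3) have off: "ends K x = ends G x" if "x \<in> arcs (underlying G)" "x \<noteq> f" "x \<noteq> einv G f" for x
    using that by (cases "x = e \<or> x = einv G e") auto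
  have cone: "cone K = cone G" by (simp add: cone_def premove_primes_of[OF K(1)])
  have path_cong: "affine_path K p fs q = affine_path G p fs q" if "f \<notin> set fs" "einv G f \<notin> set fs" for p fs
    using that
  proof (induction fs arbitrary: p)
    case Nil
    show ?case by (simp add: points_def fr cone)
  next
    case (Cons x fs)
    then have "ends K x = ends G x" if "x \<in> arcs (underlying G)" using off that by auto
    with Cons show ?case by (auto simp: ends_eq fr cone)
  qed
  have "affine_path K (ahead K f) es q"
    using path path_cong[of es] Cons.prems K(4) by (simp add: ends_eq)
  from Cons.IH[OF K(2) _ this] Cons.prems fr
  obtain G' where G': "gbs_move\<^sup>*\<^sup>* K G'" "modifies K {f} G'" "ends G' f = (atail K f, q)" by auto
  have "gbs_move G K"
    unfolding gbs_move_def move_iff_premove using K Cons.prems(1) by blast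
  moreover have "modifies G {f} G'"
    using G'(2) off Cons.prems(1) by (auto simp: modifies_def fr)
  moreover have "atail K f = atail G f" using K(4) by (simp add: ends_eq)
  ultimately show ?case using G'(1,3) by (metis converse_rtranclp_into_rtranclp)
qed

section \<open>Edges below a class and external equivalence\<close>

text \<open>
  The edges whose class lies strictly below the class of \<open>p\<close>.
\<close>

definition lower :: "('v, 'e) pre_gbs \<Rightarrow> 'v point \<Rightarrow> 'e set" where
  "lower G p = {e \<in> arcs (underlying G). conj_le G (atail G e) p \<and> \<not> conj_le G p (atail G e)}"

context affine_graph begin

lemma ends_einv: "ends G (einv G e) = prod.swap (ends G e)"
  by (simp add: ends_eq)

lemma einv_lower: "einv G ` lower G p \<subseteq> lower G p"
proof
  fix x assume "x \<in> einv G ` lower G p"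
  then obtain e where e: "e \<in> lower G p" "x = einv G e" by blast
  then have "conj_le G (atail G e) (ahead G e)" "conj_le G (ahead G e) (atail G e)"
    using quasi_conj_edge[of e] by (auto simp: lower_def quasi_conj_def)
  then have "conj_le G (ahead G e) p \<longleftrightarrow> conj_le G (atail G e) p"
    "conj_le G p (ahead G e) \<longleftrightarrow> conj_le G p (atail G e)"
    using conj_le_trans by blast+
  with e show "x \<in> lower G p" by (simp add: lower_def)
qed

lemma conj_le_if_on_path:
  assumes "affine_path G p es q" "e \<in> set es" shows "conj_le G (atail G e) p"
  using assms
proof (induction es arbitrary: p)
  case (Cons x es)
  then obtain w where x: "x \<in> arcs (underlying G)" and w: "w \<in> cone G" "atail G x +\<^sub>a w = p"
    and path: "affine_path G (ahead G x +\<^sub>a w) es q"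
    unfolding affine_path.simps arcs_affine_rep by blast
  show ?case
  proof (cases "e = x")
    case True
    then show ?thesis using conj_le_if_le[OF atail_in_points[OF x] w(1)] w(2) by simp
  next
    case False
    then have "conj_le G (atail G e) (ahead G x +\<^sub>a w)" using Cons path by simp
    moreover have "conjugate G (ahead G x +\<^sub>a w) p"
      using conjugate_sym[OF conjugate_translate[OF conjugate_edge[OF x] w(1)]] w(2) by simp
    ultimately show ?thesis using conj_le_if_conjugate conj_le_trans by blast
  qed
qed simp

text \<open>
  All edges on an affine path from \<open>p\<close> lie weakly below \<open>p\<close>, so those outside the class of \<open>p\<close> lie
  strictly below.  In this form external equivalence refers to a set of edges that is closed downwards,
  which makes it invariant under moves.
\<close>

lemma ext_equiv_iff: "ext_equiv G p q \<longleftrightarrow> quasi_conj G p q \<and> conj_via G (lower G p) p q"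
proof -
  have "e \<in> lower G p \<longleftrightarrow> \<not> edge_quasi_conj G e p"
    if "affine_path G p es q" "e \<in> set es" for es e
    using conj_le_if_on_path[OF that] affine_path_arcs[OF that(1)] that(2)
    by (auto simp: lower_def edge_quasi_conj_def quasi_conj_def)
  then show ?thesis unfolding ext_equiv_def conj_via_def subset_iff by blast
qed

lemma edges_of_class_iff:
  assumes "Q \<in> quasi_conj_classes G" "e \<in> edges_of_class G Q"
  shows "f \<in> edges_of_class G Q \<longleftrightarrow>
    f \<in> arcs (underlying G) \<and> quasi_conj G (atail G e) (atail G f)"
  using quasi_conj_classD(2)[OF assms(1), of "atail G e" "atail G f"] assms(2)
  by (auto simp: edges_of_class_def)

lemma einv_edges_of_class:
  assumes "Q \<in> quasi_conj_classes G" "e \<in> edges_of_class G Q"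
  shows "einv G e \<in> edges_of_class G Q"
  using edges_of_class_iff[OF assms, of "einv G e"] assms(2) quasi_conj_edge
  by (auto simp: edges_of_class_def)

end

text \<open>
  The invariants of moves.  Similar graphs have the same points, the same classes with the same edges
  in them, and the same external equivalence.
\<close>

definition similar :: "('v, 'e) pre_gbs \<Rightarrow> ('v, 'e) pre_gbs \<Rightarrow> bool" where
  "similar G K \<longleftrightarrow> gbs_graph G \<and> gbs_graph K \<and>
     verts (underlying K) = verts (underlying G) \<and> arcs (underlying K) = arcs (underlying G) \<and>
     einv K = einv G \<and> primes_of K = primes_of G \<and> conjugate K = conjugate G \<and>
     (\<forall>e \<in> arcs (underlying G). quasi_conj G (atail G e) (atail K e)) \<and>
     (\<forall>p. conj_via K (lower G p) = conj_via G (lower G p))"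

lemma similarD:
  assumes "similar G K"
  shows "points K = points G" "cone K = cone G" "conj_le K = conj_le G" "quasi_conj K = quasi_conj G"
    "quasi_conj_classes K = quasi_conj_classes G" "lower K = lower G"
    and "Q \<in> quasi_conj_classes G \<Longrightarrow> edges_of_class K Q = edges_of_class G Q"
proof -
  interpret G: affine_graph G using assms by (simp add: similar_def gbs_graphD)
  show cone: "cone K = cone G" using assms by (simp add: similar_def cone_def)
  then show pts: "points K = points G" using assms by (simp add: points_def similar_def)
  have "point_le K = point_le G" by (simp add: point_le_def cone fun_eq_iff)
  then show le: "conj_le K = conj_le G"
    using assms by (simp add: conj_le_def similar_def fun_eq_iff pts)
  then show qc: "quasi_conj K = quasi_conj G" by (simp add: quasi_conj_def fun_eq_iff)
  then show "quasi_conj_classes K = quasi_conj_classes G" by (simp add: quasi_conj_classes_def pts)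
  have e: "conj_le G (atail G e) (atail K e)" "conj_le G (atail K e) (atail G e)"
    if "e \<in> arcs (underlying G)" for e
    using assms that by (auto simp: similar_def quasi_conj_def)
  have "conj_le G (atail K e) p \<longleftrightarrow> conj_le G (atail G e) p" "conj_le G p (atail K e) \<longleftrightarrow> conj_le G p (atail G e)"
    if "e \<in> arcs (underlying G)" for e p
    using e[OF that] G.conj_le_trans by blast+
  then show "lower K = lower G" using assms by (auto simp: lower_def le similar_def fun_eq_iff)
  show "edges_of_class K Q = edges_of_class G Q" if Q: "Q \<in> quasi_conj_classes G"
  proof -
    have "atail K e \<in> Q \<longleftrightarrow> atail G e \<in> Q" if "e \<in> arcs (underlying G)" for e
    proof -
      have "quasi_conj G (atail G e) (atail K e)" using assms that by (simp add: similar_def)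
      then show ?thesis using G.quasi_conj_classD(2)[OF Q] G.quasi_conj_sym by blast
    qed
    with assms show ?thesis by (auto simp: edges_of_class_def similar_def)
  qed
qed

lemma similar_sym: "similar G K \<Longrightarrow> similar K G"
  using similarD(4)[of G K] similarD(6)[of G K] affine_graph.quasi_conj_sym[of G]
  by (auto simp: similar_def gbs_graphD)

lemma similar_trans: "similar G H \<Longrightarrow> similar H K \<Longrightarrow> similar G K"
  using similarD(4)[of G H] similarD(6)[of G H] affine_graph.quasi_conj_trans[of G]
  unfolding similar_def gbs_graph_iff by metis

lemma similar_if_same_ends:
  assumes G: "gbs_graph G" and K: "gbs_graph K"
    and fr: "verts (underlying K) = verts (underlying G)" "arcs (underlying K) = arcs (underlying G)"
      "einv K = einv G"
    and ends: "\<And>e. e \<in> arcs (underlying G) \<Longrightarrow> ends K e = ends G e"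
  shows "similar G K"
proof -
  interpret G: affine_graph G using G by (rule gbs_graphD)
  interpret K: affine_graph K using K by (rule gbs_graphD)
  have e: "atail K e = atail G e" "ahead K e = ahead G e" if "e \<in> arcs (underlying G)" for e
    using ends[OF that] by (simp_all add: ends_eq)
  have pr: "primes_of K = primes_of G"
    unfolding G.primes_of_conv K.primes_of_conv fr(2) using e by simp
  have cone: "cone K = cone G" by (simp add: cone_def pr)
  have pts: "points K = points G" by (simp add: points_def cone fr)
  have "conj_via K S p q \<longleftrightarrow> conj_via G S p q" for S p q
  proof
    assume "conj_via K S p q" then show "conj_via G S p q"
      by (rule conj_via_transfer[OF _ G.affine_graph_axioms pts cone])
        (use fr e G.conj_via_edge in simp)
  next
    assume "conj_via G S p q" then show "conj_via K S p q"
      by (rule conj_via_transfer[OF _ K.affine_graph_axioms pts[symmetric] cone[symmetric]])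
        (use fr e K.conj_via_edge in \<open>metis\<close>)
  qed
  then have cv: "conj_via K S = conj_via G S" for S by (simp add: fun_eq_iff)
  then show ?thesis
    using G K fr pr e G.quasi_conj_refl
    by (simp add: similar_def G.conjugate_conv K.conjugate_conv)
qed

lemma similar_refl: "gbs_graph G \<Longrightarrow> similar G G"
  by (rule similar_if_same_ends) auto

text \<open>
  The relation generated by the edges below \<open>p\<close> survives because a slide whose moving edge is below
  \<open>p\<close> has its fixed edge below \<open>p\<close> as well, while both edges of another move are in the same class.
\<close>

lemma similar_premove:
  assumes G: "gbs_graph G" and pm: "premove G e f G'"
  shows "similar G G'"
proof -
  interpret G: affine_graph G using G by (rule gbs_graphD)
  interpret G': affine_graph G' using pm by (simp add: premove_def)
  have ef: "e \<in> arcs (underlying G)" "f \<in> arcs (underlying G)"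
    and fr: "verts (underlying G') = verts (underlying G)"
      "arcs (underlying G') = arcs (underlying G)" "einv G' = einv G"
    and off: "\<And>x. x \<in> arcs (underlying G) \<Longrightarrow> x \<notin> {e, f, einv G e, einv G f} \<Longrightarrow> ends G' x = ends G x"
    and el: "elementary (primes_of G) (ends G e) (ends G f) (ends G' e) (ends G' f)"
    using pm by (auto simp: premove_def distinct_edges_def)
  have conj: "conjugate G' = conjugate G"
    using premove_conj_via[OF pm, of "arcs (underlying G)"] ef fr
    by (simp add: G.conjugate_conv G'.conjugate_conv image_subset_iff fun_eq_iff)
  have ce: "conjugate G (fst (ends G e)) (snd (ends G e))" "conjugate G (fst (ends G f)) (snd (ends G f))"
    using ef G.conjugate_edge by (simp_all add: ends_eq)
  have cases: "(ends G' e = ends G e \<and> atail G' f = atail G f \<and> conj_le G (atail G e) (atail G f)) \<or>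
     (quasi_conj G (atail G e) (atail G f) \<and> quasi_conj G (atail G e) (atail G' e) \<and>
      quasi_conj G (atail G f) (atail G' f))"
    using G.elementary_classes[OF el ce] by (simp add: ends_eq) metis
  have rev: "quasi_conj G (atail G (einv G x)) (atail G' (einv G x))"
    if "quasi_conj G (atail G x) (atail G' x)" "x \<in> arcs (underlying G)" for x
  proof -
    have "quasi_conj G (atail G x) (ahead G x)" "quasi_conj G (atail G' x) (ahead G' x)"
      using G.quasi_conj_edge[OF that(2)] G'.conjugate_edge[of x] that(2) fr conj G.quasi_conj_if_conjugate
      by auto
    with that(1) have "quasi_conj G (ahead G x) (ahead G' x)"
      using G.quasi_conj_trans G.quasi_conj_sym by blast
    then show ?thesis using G'.atail_einv[of x] by (simp add: fr)
  qed
  have qe: "quasi_conj G (atail G e) (atail G' e)" and qf: "quasi_conj G (atail G f) (atail G' f)"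
    using cases G.quasi_conj_refl[of "atail G e"] G.quasi_conj_refl[of "atail G f"] ef
    by (auto simp: ends_eq)
  have qc: "quasi_conj G (atail G x) (atail G' x)" if x: "x \<in> arcs (underlying G)" for x
  proof (cases "x \<in> {e, f, einv G e, einv G f}")
    case True
    then show ?thesis using qe qf rev ef by auto
  next
    case False
    then show ?thesis using off[OF x False] G.quasi_conj_refl x by (simp add: ends_eq)
  qed
  have low: "conj_via G' (lower G p) = conj_via G (lower G p)" for p
  proof -
    have "e \<in> lower G p \<and> f \<in> lower G p \<or> f \<notin> lower G p \<and> (e \<in> lower G p \<longrightarrow> ends G' e = ends G e)"
      using cases ef unfolding lower_def quasi_conj_def using G.conj_le_trans by blast
    from premove_conj_via[OF pm G.einv_lower this] show ?thesis by (simp add: fun_eq_iff)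
  qed
  show ?thesis
    unfolding similar_def
    using G premove_gbs_graph[OF G pm] fr premove_primes_of[OF pm] conj qc low by blast
qed

lemma gbs_move_iff:
  "gbs_move G G' \<longleftrightarrow> gbs_graph G \<and> (\<exists>e f. premove G e f G')"
  unfolding gbs_move_def move_iff_premove using premove_gbs_graph[of G _ _ G'] by blast

lemma similar_gbs_moves:
  assumes "gbs_move\<^sup>*\<^sup>* G H" "gbs_graph G" shows "similar G H"
  using assms(1)
proof (induction rule: rtranclp_induct)
  case (step H K)
  then have "similar H K" using similar_premove by (auto simp: gbs_move_iff)
  with step.IH show ?case by (rule similar_trans)
qed (rule similar_refl[OF assms(2)])

text \<open>
  The path that witnesses external equivalence avoids the sliding edge, as the latter is
  quasi-conjugate to its own endpoint.
\<close>

lemma external_slide_by_slides: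
  assumes G: "gbs_graph G" and f: "f \<in> arcs (underlying G)" and ee: "ext_equiv G (ahead G f) q"
  obtains G' where "gbs_move\<^sup>*\<^sup>* G G'" "modifies G {f} G'" "ends G' f = (atail G f, q)"
    "external_slide G f G'"
proof -
  interpret G: affine_graph G using G by (rule gbs_graphD)
  obtain es where es: "affine_path G (ahead G f) es q" "\<forall>x \<in> set es. \<not> edge_quasi_conj G x (ahead G f)"
    using ee by (auto simp: ext_equiv_def)
  moreover have "f \<notin> set es" "einv G f \<notin> set es"
    using es(2) G.quasi_conj_edge[OF f] G.quasi_conj_refl[OF G.ahead_in_points[OF f]] G.atail_einv[of f]
    by (auto simp: edge_quasi_conj_def)
  ultimately obtain G' where G': "gbs_move\<^sup>*\<^sup>* G G'" "modifies G {f} G'" "ends G' f = (atail G f, q)"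
    using path_slides[OF G f] by blast
  moreover have "external_slide G f G'"
    using G' f ee unfolding external_slide_def by (auto simp: ends_eq)
  ultimately show ?thesis using that by blast
qed

lemma similar_move_within:
  assumes "move_within Q G G'"
  shows "similar G G'"
proof -
  consider e f where "slide G e f G' \<or> swap G e f G' \<or> connection G e f G'"
    | f where "external_slide G f G'"
    using assms unfolding move_within_def internal_slide_def by blast
  then show ?thesis
  proof cases
    case 1
    then show ?thesis unfolding move_iff_premove using similar_premove[of G e f G'] by blast
  next
    case (2 f)
    then have f: "f \<in> arcs (underlying G)" and m: "modifies G {f} G'"
      and ee: "ext_equiv G (ahead G f) (ahead G' f)" and tl: "atail G' f = atail G f"
      by (auto simp: external_slide_def ends_eq)
    have G: "gbs_graph G" using m by (simp add: modifies_def)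
    obtain H where H: "gbs_move\<^sup>*\<^sup>* G H" "modifies G {f} H" "ends H f = (atail G f, ahead G' f)"
      using external_slide_by_slides[OF G f ee] by blast
    interpret H: affine_graph H using H(2) by (simp add: modifies_def gbs_graphD)
    interpret G': affine_graph G' using m by (simp add: modifies_def gbs_graphD)
    have "ends H f = ends G' f" using H(3) tl by (simp add: ends_eq)
    then have "ends H (einv G f) = ends G' (einv G f)"
      using H.ends_einv[of f] G'.ends_einv[of f] H(2) m by (simp add: modifies_def)
    then have "ends G' x = ends H x" if "x \<in> arcs (underlying G)" for x
      using H m tl that by (cases "x \<in> {f, einv G f}") (auto simp: modifies_def ends_eq)
    then have "similar H G'"
      using H(2) m by (intro similar_if_same_ends) (auto simp: modifies_def)
    with similar_gbs_moves[OF H(1) G] show ?thesis by (rule similar_trans)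
  qed
qed

section \<open>Moves seen from a single class\<close>

text \<open>
  A move can be copied to any similar graph in which the two edges have the same endpoints.
\<close>

lemma transfer_premove:
  assumes pm: "premove G e f G'" and K: "gbs_graph K" and sim: "similar G K"
    and e: "ends K e = ends G e" "ends K f = ends G f"
  obtains K' where "premove K e f K'" "gbs_graph K'"
    "\<And>x. x \<in> arcs (underlying G) \<Longrightarrow> ends K x = ends G x \<Longrightarrow> ends K' x = ends G' x"
    "\<And>x. x \<in> arcs (underlying G) \<Longrightarrow> x \<notin> {e, f, einv G e, einv G f} \<Longrightarrow> ends K' x = ends K x"
proof -
  have "distinct_edges K e f" "elementary (primes_of K) (ends K e) (ends K f) (ends G' e) (ends G' f)"
    using pm sim e by (auto simp: premove_def distinct_edges_def similar_def)
  from move_exists[OF K this] obtain K' where K': "premove K e f K'" "gbs_graph K'"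
    "ends K' e = ends G' e" "ends K' f = ends G' f" .
  interpret G': affine_graph G' using pm by (simp add: premove_def)
  interpret K': affine_graph K' using K'(2) by (rule gbs_graphD)
  have einv: "einv K' = einv G" "einv G' = einv G" and arcs: "arcs (underlying K) = arcs (underlying G)"
    "einv K = einv G"
    using pm K'(1) sim by (auto simp: premove_def similar_def)
  have inv: "ends K' (einv G e) = ends G' (einv G e)" "ends K' (einv G f) = ends G' (einv G f)"
    using K'.ends_einv G'.ends_einv K' by (simp_all add: einv)
  have off: "ends K' x = ends K x" "ends G' x = ends G x"
    if "x \<in> arcs (underlying G)" "x \<notin> {e, f, einv G e, einv G f}" for x
    using K'(1) pm that by (auto simp: premove_def arcs)
  show ?thesis
    using that[OF K'(1,2)] inv off K'(3,4) by (metis insertE singletonD)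
qed

lemma move_within_if_premove:
  assumes pm: "premove G e f G'" and G: "gbs_graph G" and Q: "Q \<in> quasi_conj_classes G"
    and ef: "e \<in> edges_of_class G Q" "f \<in> edges_of_class G Q"
  shows "move_within Q G G'"
proof -
  interpret G: affine_graph G using G by (rule gbs_graphD)
  have "slide G e f G' \<or> swap G e f G' \<or> connection G e f G'"
    unfolding move_iff_premove using pm G premove_gbs_graph[OF G pm] by blast
  moreover have "edge_quasi_conj G e (atail G f)"
    using G.edges_of_class_iff[OF Q ef(1)] ef(2) by (simp add: edge_quasi_conj_def)
  ultimately show ?thesis using ef unfolding move_within_def internal_slide_def by blast
qed

text \<open>
  If \<open>K\<close> has the same edges in \<open>Q\<close> as \<open>G\<close>, then \<open>K\<close> can follow the change that a move of \<open>G\<close> makes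
  in \<open>Q\<close> without touching other classes.  The edge \<open>e\<close> over which an edge of \<open>Q\<close> slides in \<open>G\<close>
  may have other endpoints in \<open>K\<close>; still its two ends are joined in \<open>K\<close> by a path below \<open>Q\<close>, since \<open>K\<close> has
  the same external equivalence.
\<close>

lemma move_seen_from_class:
  assumes mv: "gbs_move G G'" and sim: "similar G K" and Q: "Q \<in> quasi_conj_classes G"
    and agree: "\<forall>x \<in> edges_of_class G Q. ends K x = ends G x"
  obtains K' where "(move_within Q)\<^sup>*\<^sup>* K K'" "\<forall>x \<in> edges_of_class G Q. ends K' x = ends G' x"
proof -
  note finish = that
  define E where "E = edges_of_class G Q"
  obtain e f where G: "gbs_graph G" and pm: "premove G e f G'" using mv by (auto simp: gbs_move_iff)
  interpret G: affine_graph G using G by (rule gbs_graphD)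
  interpret G': affine_graph G' using pm by (simp add: premove_def)
  have K: "gbs_graph K" using sim by (simp add: similar_def)
  interpret K: affine_graph K using K by (rule gbs_graphD)
  have QK: "Q \<in> quasi_conj_classes K" and EK: "edges_of_class K Q = E"
    using similarD(5,7)[OF sim] Q by (simp_all add: E_def)
  have E: "x \<in> arcs (underlying G)" if "x \<in> E" for x using that by (simp add: E_def edges_of_class_def)
  have Einv: "einv G x \<in> E \<longleftrightarrow> x \<in> E" for x
    using G.einv_edges_of_class[OF Q] G.arev_arev unfolding E_def by metis
  have Eqc: "f \<in> E" if "e \<in> E" "quasi_conj G (atail G e) (atail G f)" "f \<in> arcs (underlying G)" for e f
    using G.edges_of_class_iff[OF Q] that unfolding E_def by blast
  have ef: "e \<in> arcs (underlying G)" "f \<in> arcs (underlying G)"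
    and fr: "einv G' = einv G"
    and off: "\<And>x. x \<in> arcs (underlying G) \<Longrightarrow> x \<notin> {e, f, einv G e, einv G f} \<Longrightarrow> ends G' x = ends G x"
    and el: "elementary (primes_of G) (ends G e) (ends G f) (ends G' e) (ends G' f)"
    using pm by (auto simp: premove_def distinct_edges_def)
  have frK: "arcs (underlying K) = arcs (underlying G)" "einv K = einv G"
    using sim by (simp_all add: similar_def)
  have both: ?thesis if "e \<in> E" "f \<in> E"
  proof -
    have "ends K e = ends G e" "ends K f = ends G f" using agree that by (simp_all add: E_def)
    from transfer_premove[OF pm K sim this] obtain K' where K': "premove K e f K'"
      "\<And>x. x \<in> arcs (underlying G) \<Longrightarrow> ends K x = ends G x \<Longrightarrow> ends K' x = ends G' x"
      by blast
    then have "move_within Q K K'" using move_within_if_premove[OF _ K QK] EK that by blast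
    with K'(2) agree E show ?thesis by (intro finish[of K']) (auto simp: E_def)
  qed
  have none: ?thesis if "\<And>x. x \<in> E \<Longrightarrow> ends G' x = ends G x"
    using that agree by (intro finish[of K]) (auto simp: E_def)
  have ce: "conjugate G (fst (ends G e)) (snd (ends G e))" "conjugate G (fst (ends G f)) (snd (ends G f))"
    using ef G.conjugate_edge by (simp_all add: ends_eq)
  show ?thesis
  proof (cases rule: G.elementary_classes[OF el ce])
    case loops: 2
    have "e \<in> E \<longleftrightarrow> f \<in> E"
      using Eqc ef loops(1) G.quasi_conj_sym[of "atail G e" "atail G f"] by (auto simp: ends_eq)
    then show ?thesis using both none off E Einv by blast
  next
    case (1 a)
    then have same: "ends G' e = ends G e" "ends G' (einv G e) = ends G (einv G e)"
      using G.ends_einv[of e] G'.ends_einv[of e] by (simp_all add: fr)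
    show ?thesis
    proof (cases "f \<in> E")
      case False
      then have "ends G' x = ends G x" if "x \<in> E" for x
        using that same off[OF E[OF that]] Einv by (cases "x \<in> {e, einv G e}") auto
      then show ?thesis by (rule none)
    next
      case f: True
      show ?thesis
      proof (cases "e \<in> E")
        case True with f both show ?thesis by blast
      next
        case e: False
        define p where "p = ahead G f"
        define q where "q = ahead G' f"
        have p: "p = atail G e +\<^sub>a a" and q: "q = ahead G e +\<^sub>a a" and tl: "atail G' f = atail G f"
          using 1 by (simp_all add: p_def q_def ends_eq)
        have "conj_le G (atail G e) p"
          using G.conj_le_if_le[OF G.atail_in_points[OF ef(1)] 1(4)] by (simp add: p)
        moreover have "\<not> quasi_conj G (atail G e) p"
          using e Eqc[OF f _ ef(1)] G.quasi_conj_edge[OF ef(2)] G.quasi_conj_trans G.quasi_conj_sym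
          unfolding p_def by blast
        ultimately have "e \<in> lower G p"
          using ef(1) by (auto simp: lower_def quasi_conj_def)
        then have "conj_via G (lower G p) p q"
          using G.conj_via_translate[OF G.conj_via_edge[OF ef(1)] 1(4)] by (simp add: p q)
        moreover have "quasi_conj G p q"
          using G.conjugate_translate[OF G.conjugate_edge[OF ef(1)] 1(4)] G.quasi_conj_if_conjugate
          by (simp add: p q)
        ultimately have "ext_equiv K p q"
          unfolding K.ext_equiv_iff using similarD(4,6)[OF sim] sim by (simp add: similar_def)
        moreover have pK: "ends K f = ends G f" using agree f by (simp add: E_def)
        ultimately obtain K' where K': "modifies K {f} K'" "ends K' f = (atail G f, q)" "external_slide K f K'"
          using external_slide_by_slides[OF K, of f q] ef frK by (auto simp: p_def ends_eq)
        have "move_within Q K K'" using K'(3) f EK by (auto simp: move_within_def)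
        moreover have "ends K' x = ends G' x" if "x \<in> E" for x
        proof (cases "x \<in> {f, einv G f}")
          case True
          interpret K': affine_graph K' using K'(1) by (simp add: modifies_def gbs_graphD)
          have "ends K' f = ends G' f" using K'(2) tl by (simp add: ends_eq q_def)
          moreover have "ends K' (einv G f) = ends G' (einv G f)"
            using K'.ends_einv[of f] G'.ends_einv[of f] K'(1) calculation
            by (simp add: modifies_def frK fr)
          ultimately show ?thesis using True by blast
        next
          case False
          then have "ends K' x = ends K x" using K'(1) E[OF that] by (simp add: modifies_def frK)
          also have "\<dots> = ends G x" using agree that by (simp add: E_def)
          also have "\<dots> = ends G' x"
            using False same off[OF E[OF that]] by (cases "x \<in> {e, einv G e}") auto
          finally show ?thesis .
        qed
        ultimately show ?thesis by (intro finish[of K']) (auto simp: E_def)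
      qed
    qed
  qed
qed

text \<open>
  Conversely, a move inside \<open>Q\<close> can be imitated by slides, swaps and connections in a similar graph whose
  other classes are arbitrary, and the other classes keep their edges.
\<close>

lemma move_within_elsewhere:
  assumes mv: "move_within Q G G'" and sim: "similar G K" and Q: "Q \<in> quasi_conj_classes G"
    and agree: "\<forall>x \<in> edges_of_class G Q. ends K x = ends G x"
  obtains K' where "gbs_move\<^sup>*\<^sup>* K K'" "\<forall>x \<in> edges_of_class G Q. ends K' x = ends G' x"
    "\<forall>x \<in> arcs (underlying G) - edges_of_class G Q. ends K' x = ends K x"
proof -
  define E where "E = edges_of_class G Q"
  have G: "gbs_graph G" and K: "gbs_graph K" using sim by (simp_all add: similar_def)
  interpret G: affine_graph G using G by (rule gbs_graphD)
  interpret K: affine_graph K using K by (rule gbs_graphD)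
  have E: "x \<in> arcs (underlying G)" if "x \<in> E" for x using that by (simp add: E_def edges_of_class_def)
  have Einv: "einv G x \<in> E" if "x \<in> E" for x
    using G.einv_edges_of_class[OF Q] that unfolding E_def by blast
  have frK: "arcs (underlying K) = arcs (underlying G)" "einv K = einv G"
    using sim by (simp_all add: similar_def)
  consider e f where "e \<in> E" "f \<in> E" "slide G e f G' \<or> swap G e f G' \<or> connection G e f G'"
    | f where "f \<in> E" "external_slide G f G'"
    using mv unfolding move_within_def internal_slide_def E_def by blast
  then show ?thesis
  proof cases
    case (1 e f)
    then have pm: "premove G e f G'" unfolding move_iff_premove by blast
    have "ends K e = ends G e" "ends K f = ends G f" using agree 1 by (simp_all add: E_def)
    from transfer_premove[OF pm K sim this] obtain K' where K': "premove K e f K'"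
      "\<And>x. x \<in> arcs (underlying G) \<Longrightarrow> ends K x = ends G x \<Longrightarrow> ends K' x = ends G' x"
      "\<And>x. x \<in> arcs (underlying G) \<Longrightarrow> x \<notin> {e, f, einv G e, einv G f} \<Longrightarrow> ends K' x = ends K x"
      by blast
    have "gbs_move K K'" using K K'(1) by (auto simp: gbs_move_iff)
    moreover have "x \<notin> {e, f, einv G e, einv G f}" if "x \<notin> E" for x using that 1 Einv by blast
    ultimately show ?thesis using K'(2,3) agree E by (intro that[of K']) (auto simp: E_def)
  next
    case (2 f)
    then have m: "modifies G {f} G'" and tl: "atail G' f = atail G f"
      and ee: "ext_equiv G (ahead G f) (ahead G' f)"
      by (auto simp: external_slide_def ends_eq)
    interpret G': affine_graph G' using m by (simp add: modifies_def gbs_graphD)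
    have Kf: "ends K f = ends G f" using agree 2 by (simp add: E_def)
    have "ext_equiv K (ahead K f) (ahead G' f)"
      using ee Kf similarD(4,6)[OF sim] sim
      unfolding K.ext_equiv_iff G.ext_equiv_iff by (simp add: similar_def ends_eq)
    then obtain K' where K': "gbs_move\<^sup>*\<^sup>* K K'" "modifies K {f} K'" "ends K' f = (atail K f, ahead G' f)"
      using external_slide_by_slides[OF K, of f] E[OF 2(1)] frK by metis
    interpret K': affine_graph K' using K'(2) by (simp add: modifies_def gbs_graphD)
    have "ends K' f = ends G' f" using K'(3) Kf tl by (simp add: ends_eq)
    moreover have "ends K' (einv G f) = ends G' (einv G f)"
      using K'.ends_einv[of f] G'.ends_einv[of f] K'(2) m calculation by (simp add: modifies_def frK)
    ultimately have "ends K' x = ends G' x" if "x \<in> E" for x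
      using that K'(2) m agree E[OF that]
      by (cases "x \<in> {f, einv G f}") (auto simp: modifies_def frK E_def)
    moreover have "ends K' x = ends K x" if "x \<in> arcs (underlying G) - E" for x
      using that K'(2) 2(1) Einv by (auto simp: modifies_def frK)
    ultimately show ?thesis using K'(1) by (intro that[of K']) (auto simp: E_def)
  qed
qed

lemma moves_seen_from_class:
  assumes "gbs_move\<^sup>*\<^sup>* G H" and G: "gbs_graph G" and Q: "Q \<in> quasi_conj_classes G"
  shows "\<exists>K. (move_within Q)\<^sup>*\<^sup>* G K \<and> similar G K \<and> (\<forall>x \<in> edges_of_class G Q. ends K x = ends H x)"
  using assms(1)
proof (induction rule: rtranclp_induct)
  case base
  then show ?case using similar_refl[OF G] by blast
next
  case (step H H')
  then obtain K where K: "(move_within Q)\<^sup>*\<^sup>* G K" "similar G K"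
    "\<forall>x \<in> edges_of_class G Q. ends K x = ends H x" by blast
  have GH: "similar G H" using similar_gbs_moves[OF step(1) G] .
  then have HK: "similar H K" using similar_trans[OF similar_sym K(2)] by blast
  have Q': "Q \<in> quasi_conj_classes H" "edges_of_class H Q = edges_of_class G Q"
    using similarD(5,7)[OF GH] Q by simp_all
  obtain K' where K': "(move_within Q)\<^sup>*\<^sup>* K K'" "\<forall>x \<in> edges_of_class G Q. ends K' x = ends H' x"
    using move_seen_from_class[OF step(2) HK Q'(1)] K(3) Q'(2) by metis
  have "similar K K'" using K'(1)
  proof (induction rule: rtranclp_induct)
    case base then show ?case using similar_refl[of K] K(2) by (simp add: similar_def)
  next
    case (step L L')
    show ?case by (rule similar_trans[OF step.IH similar_move_within[OF step.hyps(2)]])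
  qed
  then have "similar G K'" by (rule similar_trans[OF K(2)])
  moreover have "(move_within Q)\<^sup>*\<^sup>* G K'" using K(1) K'(1) by simp
  ultimately show ?case using K'(2) by blast
qed

lemma moves_within_elsewhere:
  assumes "(move_within Q)\<^sup>*\<^sup>* G H" and GK: "similar G K" and Q: "Q \<in> quasi_conj_classes G"
    and agree: "\<forall>x \<in> edges_of_class G Q. ends K x = ends G x"
  shows "\<exists>K'. gbs_move\<^sup>*\<^sup>* K K' \<and> similar G H \<and> (\<forall>x \<in> edges_of_class G Q. ends K' x = ends H x) \<and>
    (\<forall>x \<in> arcs (underlying G) - edges_of_class G Q. ends K' x = ends K x)"
  using assms(1)
proof (induction rule: rtranclp_induct)
  case base
  then show ?case using GK agree similar_refl[of G] by (auto simp: similar_def)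
next
  case (step H H')
  then obtain K' where K': "gbs_move\<^sup>*\<^sup>* K K'" "similar G H"
    "\<forall>x \<in> edges_of_class G Q. ends K' x = ends H x"
    "\<forall>x \<in> arcs (underlying G) - edges_of_class G Q. ends K' x = ends K x" by blast
  have "similar K K'" using similar_gbs_moves[OF K'(1)] GK by (simp add: similar_def)
  then have HK: "similar H K'" using similar_trans[OF similar_sym[OF K'(2)] similar_trans[OF GK]] by blast
  have Q': "Q \<in> quasi_conj_classes H" "edges_of_class H Q = edges_of_class G Q"
    "arcs (underlying H) = arcs (underlying G)"
    using similarD(5,7)[OF K'(2)] Q K'(2) by (simp_all add: similar_def)
  obtain K'' where K'': "gbs_move\<^sup>*\<^sup>* K' K''" "\<forall>x \<in> edges_of_class G Q. ends K'' x = ends H' x"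
    "\<forall>x \<in> arcs (underlying G) - edges_of_class G Q. ends K'' x = ends K' x"
    using move_within_elsewhere[OF step(2) HK Q'(1)] K'(3) Q'(2,3) by metis
  have "similar G H'" using similar_trans[OF K'(2) similar_move_within[OF step(2)]] .
  moreover have "gbs_move\<^sup>*\<^sup>* K K''" using K'(1) K''(1) by simp
  ultimately show ?case using K''(2,3) K'(4) by (intro exI[of _ K'']) simp
qed

section \<open>Configurations and isomorphisms\<close>

definition geom_edges :: "('v, 'e) pre_gbs \<Rightarrow> 'e set set" where
  "geom_edges G = (\<lambda>e. {e, einv G e}) ` arcs (underlying G)"

lemma (in affine_graph) atail_geom_edge:
  assumes "d \<in> geom_edges G" shows "atail G ` d \<subseteq> points G" "d \<noteq> {}"
proof -
  obtain e where "e \<in> arcs (underlying G)" "d = {e, einv G e}"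
    using assms unfolding geom_edges_def by blast
  then show "atail G ` d \<subseteq> points G" "d \<noteq> {}" by simp_all
qed

lemma (in affine_graph) configuration_points:
  assumes "Z \<in># configuration G Q" shows "Z \<subseteq> points G"
proof -
  define D where "D = {{e, einv G e} |e. e \<in> arcs (affine_rep G) \<and> (atail G e \<in> Q \<or> ahead G e \<in> Q)}"
  have D: "D \<subseteq> geom_edges G" by (auto simp: D_def geom_edges_def)
  moreover have "finite (geom_edges G)" by (simp add: geom_edges_def)
  ultimately have "finite D" by (rule finite_subset)
  then obtain d where "d \<in> D" "Z = atail G ` d"
    using assms unfolding configuration_def D_def[symmetric] by (metis elem_mset_set image_iff set_image_mset)
  with D atail_geom_edge(1) show ?thesis by blast
qed

text \<open>
  An edge whose endpoint set contains a point of \<open>Q\<close> has an endpoint in \<open>Q\<close>, so the configuration of \<open>Q\<close>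
  already counts all edges with that endpoint set.
\<close>

lemma (in affine_graph) count_configuration:
  assumes "x \<in> X" "x \<in> Q"
  shows "card {d \<in> geom_edges G. atail G ` d = X} = count (configuration G Q) X"
proof -
  define D where "D = {{e, einv G e} |e. e \<in> arcs (affine_rep G) \<and> (atail G e \<in> Q \<or> ahead G e \<in> Q)}"
  have "D \<subseteq> geom_edges G" by (auto simp: D_def geom_edges_def)
  moreover have "finite (geom_edges G)" by (simp add: geom_edges_def)
  ultimately have fin: "finite D" by (rule finite_subset)
  have "count (configuration G Q) X = card {d \<in> D. atail G ` d = X}"
    unfolding configuration_def D_def[symmetric]
    by (simp add: count_image_mset' fin sum.If_cases Int_def eq_commute[of X] flip: sum.inter_filter)
  also have "{d \<in> D. atail G ` d = X} = {d \<in> geom_edges G. atail G ` d = X}"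
  proof (intro equalityI subsetI)
    fix d assume "d \<in> {d \<in> geom_edges G. atail G ` d = X}"
    then obtain e where e: "e \<in> arcs (underlying G)" "d = {e, einv G e}" "atail G ` d = X"
      by (auto simp: geom_edges_def)
    with assms have "atail G e \<in> Q \<or> ahead G e \<in> Q" by auto
    with e show "d \<in> {d \<in> D. atail G ` d = X}" by (auto simp: D_def)
  qed (use \<open>D \<subseteq> geom_edges G\<close> in blast)
  finally show ?thesis by simp
qed

lemma bij_betw_if_card_fibres_eq:
  assumes "finite A" "finite B" and "\<And>x. card {a \<in> A. f a = x} = card {b \<in> B. g b = x}"
  obtains \<phi> where "bij_betw \<phi> A B" "\<And>a. a \<in> A \<Longrightarrow> g (\<phi> a) = f a"
proof -
  have "\<exists>h. bij_betw h {a \<in> A. f a = x} {b \<in> B. g b = x}" for x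
    using assms by (intro finite_same_card_bij) auto
  then obtain h where h: "\<And>x. bij_betw (h x) {a \<in> A. f a = x} {b \<in> B. g b = x}" by metis
  define \<phi> where "\<phi> a = h (f a) a" for a
  have in_B: "\<phi> a \<in> B \<and> g (\<phi> a) = f a" if "a \<in> A" for a
    using bij_betwE[OF h[of "f a"]] that by (auto simp: \<phi>_def)
  have "bij_betw \<phi> A B"
  proof (rule bij_betw_imageI)
    show "inj_on \<phi> A"
    proof (rule inj_onI)
      fix a a' assume a: "a \<in> A" "a' \<in> A" "\<phi> a = \<phi> a'"
      then have "f a = f a'" using in_B by metis
      with a h[of "f a"] show "a = a'" by (auto simp: \<phi>_def bij_betw_def inj_on_def)
    qed
    show "\<phi> ` A = B"
    proof
      show "B \<subseteq> \<phi> ` A"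
      proof
        fix b assume b: "b \<in> B"
        then have "b \<in> h (g b) ` {a \<in> A. f a = g b}"
          using h[of "g b"] by (auto simp: bij_betw_def)
        then obtain a where "a \<in> A" "f a = g b" "b = h (g b) a" by blast
        then have "b = \<phi> a" by (simp add: \<phi>_def)
        with \<open>a \<in> A\<close> show "b \<in> \<phi> ` A" by blast
      qed
    qed (use in_B in blast)
  qed
  with that in_B show ?thesis by blast
qed

text \<open>
  A bijection of unoriented edges that respects endpoints lifts to oriented edges.  One orientation of
  each edge of \<open>K\<close> is chosen and mapped to an orientation with the right initial point; the other
  orientation goes to the reverse.  This also covers edges with equal endpoints, where
  either orientation of the image would do.
\<close>

lemma gbs_iso_over_if_ends_match:
  assumes K: "affine_graph K" and G': "affine_graph G'"
    and \<beta>: "bij_betw \<beta> (verts (underlying K)) (verts (underlying G'))"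
    and \<Phi>: "bij_betw \<Phi> (geom_edges K) (geom_edges G')"
    and ends: "\<And>d. d \<in> geom_edges K \<Longrightarrow> atail G' ` \<Phi> d = point_map \<beta> ` atail K ` d"
  shows "gbs_iso_over \<beta> K G'"
proof -
  interpret K: affine_graph K by fact
  interpret G': affine_graph G' by fact
  let ?A = "arcs (underlying K)" and ?B = "arcs (underlying G')"
  define d where "d e = {e, einv K e}" for e
  have d: "d e \<in> geom_edges K" if "e \<in> ?A" for e using that by (auto simp: d_def geom_edges_def)
  have d_einv: "d (einv K e) = d e" for e by (auto simp: d_def)
  have d_eq: "d e = d e' \<longleftrightarrow> e' = e \<or> e' = einv K e" for e e'
    by (auto simp: d_def doubleton_eq_iff)
  define rep where "rep D = (SOME e. e \<in> D)" for D :: "'b set"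
  have rep: "rep (d e) = e \<or> rep (d e) = einv K e" for e
    using someI[of "\<lambda>x. x \<in> d e" e] by (auto simp: rep_def d_def)
  have "\<exists>y. y \<in> \<Phi> (d e) \<and> atail G' y = point_map \<beta> (atail K e)" if "e \<in> ?A" for e
  proof -
    have "point_map \<beta> (atail K e) \<in> atail G' ` \<Phi> (d e)"
      unfolding ends[OF d[OF that]] by (simp add: d_def)
    then show ?thesis by auto
  qed
  then obtain \<psi> where \<psi>: "\<And>e. e \<in> ?A \<Longrightarrow> \<psi> e \<in> \<Phi> (d e) \<and> atail G' (\<psi> e) = point_map \<beta> (atail K e)"
    by metis
  define \<phi> where "\<phi> e = (if rep (d e) = e then \<psi> e else einv G' (\<psi> (einv K e)))" for e
  have \<Phi>_in: "\<Phi> (d e) \<in> geom_edges G'" if "e \<in> ?A" for e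
    using bij_betwE[OF \<Phi>] d[OF that] by blast
  have \<Phi>_eq: "\<Phi> (d e) = {y, einv G' y}" "y \<in> ?B" if "e \<in> ?A" "y \<in> \<Phi> (d e)" for e y
  proof -
    from \<Phi>_in[OF that(1)] obtain z where z: "z \<in> ?B" "\<Phi> (d e) = {z, einv G' z}"
      unfolding geom_edges_def by blast
    then have "y = z \<or> y = einv G' z" using that(2) by blast
    then show "\<Phi> (d e) = {y, einv G' y}" "y \<in> ?B"
      using z by (elim disjE; simp add: insert_commute)+
  qed
  have hd: "ahead G' y = point_map \<beta> (ahead K e)"
    if "e \<in> ?A" "y \<in> \<Phi> (d e)" "atail G' y = point_map \<beta> (atail K e)" for e y
  proof -
    have "{atail G' y, ahead G' y} = {point_map \<beta> (atail K e), point_map \<beta> (ahead K e)}"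
      using ends[OF d[OF that(1)]] unfolding \<Phi>_eq(1)[OF that(1,2)] by (simp add: d_def)
    then show ?thesis using that(3) by (auto simp: doubleton_eq_iff)
  qed
  have \<phi>: "\<phi> e \<in> \<Phi> (d e) \<and> atail G' (\<phi> e) = point_map \<beta> (atail K e)" if e: "e \<in> ?A" for e
  proof (cases "rep (d e) = e")
    case False
    have e': "einv K e \<in> ?A" using e by simp
    note p = \<psi>[OF e']
    have "ahead G' (\<psi> (einv K e)) = point_map \<beta> (atail K e)"
      using hd[OF e'] p by simp
    moreover have "einv G' (\<psi> (einv K e)) \<in> \<Phi> (d e)"
      using \<Phi>_eq(1)[OF e', of "\<psi> (einv K e)"] p by (simp add: d_einv)
    ultimately show ?thesis using False by (simp add: \<phi>_def)
  qed (use \<psi>[OF e] in \<open>simp add: \<phi>_def\<close>)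
  have inB: "\<phi> e \<in> ?B" if "e \<in> ?A" for e using \<Phi>_eq(2)[OF that] \<phi>[OF that] by blast
  have ahd: "ahead G' (\<phi> e) = point_map \<beta> (ahead K e)" if "e \<in> ?A" for e
    using hd[OF that] \<phi>[OF that] by blast
  have inv: "\<phi> (einv K e) = einv G' (\<phi> e)" if "e \<in> ?A" for e
  proof -
    have "e \<noteq> einv K e" using K.arev_neq[OF that] by metis
    then show ?thesis using rep[of e] by (auto simp: \<phi>_def d_einv)
  qed
  have "bij_betw \<phi> ?A ?B"
  proof (rule bij_betw_imageI)
    show "inj_on \<phi> ?A"
    proof (rule inj_onI)
      fix e e' assume e: "e \<in> ?A" "e' \<in> ?A" "\<phi> e = \<phi> e'"
      have "\<Phi> (d e) = \<Phi> (d e')"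
        using \<Phi>_eq(1)[of e "\<phi> e"] \<Phi>_eq(1)[of e' "\<phi> e'"] \<phi>[OF e(1)] \<phi>[OF e(2)] e by simp
      then have "d e = d e'" using \<Phi> d e by (metis bij_betw_inv_into_left)
      then consider "e' = e" | "e' = einv K e" by (auto simp: d_eq)
      then show "e = e'"
      proof cases
        case 2
        with inv e have "einv G' (\<phi> e) = \<phi> e" by simp
        with G'.arev_neq[OF inB[OF e(1)]] show ?thesis by simp
      qed simp
    qed
    show "\<phi> ` ?A = ?B"
    proof
      show "?B \<subseteq> \<phi> ` ?A"
      proof
        fix y assume y: "y \<in> ?B"
        then have "{y, einv G' y} \<in> \<Phi> ` geom_edges K"
          using bij_betw_imp_surj_on[OF \<Phi>] by (auto simp: geom_edges_def)
        then obtain e where e: "e \<in> ?A" "{y, einv G' y} = \<Phi> (d e)"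
          by (auto simp: geom_edges_def d_def)
        with \<phi>[OF e(1)] have "\<phi> e = y \<or> \<phi> e = einv G' y" by blast
        then have "\<phi> e = y \<or> \<phi> (einv K e) = y" using inv[OF e(1)] by auto
        with e(1) show "y \<in> \<phi> ` ?A" by (metis K.arev_in_arcs imageI)
      qed
    qed (use inB in blast)
  qed
  moreover have "\<phi> (einv K e) = einv G' (\<phi> e) \<and>
      tail (underlying G') (\<phi> e) = \<beta> (tail (underlying K) e) \<and>
      head (underlying G') (\<phi> e) = \<beta> (head (underlying K) e) \<and> label G' (\<phi> e) = label K e"
    if e: "e \<in> ?A" for e
  proof -
    have "tail (underlying G') (\<phi> e) = \<beta> (tail (underlying K) e)"
      using \<phi>[OF e] K.fst_atail[OF e] G'.fst_atail[OF inB[OF e]] by (simp add: point_map_def)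
    moreover have "head (underlying G') (\<phi> e) = \<beta> (head (underlying K) e)"
      using ahd[OF e] by (simp add: point_map_def flip: fst_ahead)
    moreover have "avec_of_int (label G' (\<phi> e)) = avec_of_int (label K e)"
      using ahd[OF e] by (simp add: point_map_def flip: snd_ahead)
    then have "label G' (\<phi> e) = label K e"
      using avec_of_int_inject G'.label_nonzero[OF inB[OF e]] K.label_nonzero[OF e] by blast
    ultimately show ?thesis using inv[OF e] by blast
  qed
  ultimately show ?thesis using \<beta> unfolding gbs_iso_over_def by blast
qed

lemma configuration_cong:
  assumes "affine_graph G" "affine_graph K"
    and "arcs (underlying K) = arcs (underlying G)" "einv K = einv G"
    and same: "\<And>e. e \<in> arcs (underlying G) \<Longrightarrow>
       atail G e \<in> Q \<or> ahead G e \<in> Q \<or> atail K e \<in> Q \<or> ahead K e \<in> Q \<Longrightarrow> ends K e = ends G e"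
  shows "configuration K Q = configuration G Q"
proof -
  interpret G: affine_graph G by fact
  interpret K: affine_graph K by fact
  have D: "{{e, einv K e} |e. e \<in> arcs (affine_rep K) \<and> (atail K e \<in> Q \<or> ahead K e \<in> Q)} =
        {{e, einv G e} |e. e \<in> arcs (affine_rep G) \<and> (atail G e \<in> Q \<or> ahead G e \<in> Q)}"
    (is "?DK = ?DG")
    using same assms(3,4) by (auto simp: ends_eq) metis+
  have fin: "finite ?DG" by (rule finite_subset[of _ "geom_edges G"]) (auto simp: geom_edges_def)
  show ?thesis unfolding configuration_def D
  proof (rule image_mset_cong)
    fix d assume "d \<in># mset_set ?DG"
    then obtain e where e: "e \<in> arcs (underlying G)" "d = {e, einv G e}" "atail G e \<in> Q \<or> ahead G e \<in> Q"
      using fin by auto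
    then have "ends K e = ends G e" using same by blast
    with e show "atail K ` d = atail G ` d"
      using K.atail_einv[of e] assms(4) by (simp add: ends_eq)
  qed
qed

text \<open>
  An edge with an endpoint in the class \<open>Q\<close> belongs to \<open>Q\<close>, hence a configuration only depends on the edges
  of the class, and those are the same edges in similar graphs.
\<close>

lemma similar_configuration:
  assumes sim: "similar G H" "similar G K" and Q: "Q \<in> quasi_conj_classes G"
    and agree: "\<forall>x \<in> edges_of_class G Q. ends H x = ends K x"
  shows "configuration H Q = configuration K Q"
proof -
  have touch: "e \<in> edges_of_class G Q"
    if L: "similar G L" and e: "e \<in> arcs (underlying G)" "atail L e \<in> Q \<or> ahead L e \<in> Q" for L e
  proof -
    interpret L: affine_graph L using L by (simp add: similar_def gbs_graphD)
    have e': "e \<in> arcs (underlying L)" using L e by (simp add: similar_def)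
    have "atail L e \<in> Q"
      using e(2) L.quasi_conj_classD(2)[of Q "ahead L e" "atail L e"] L.quasi_conj_sym[OF L.quasi_conj_edge[OF e']]
        similarD(5)[OF L] Q by blast
    then have "e \<in> edges_of_class L Q" using e' by (simp add: edges_of_class_def)
    then show ?thesis using similarD(7)[OF L Q] by simp
  qed
  show ?thesis
  proof (rule configuration_cong)
    show "affine_graph K" "affine_graph H" using sim by (simp_all add: similar_def gbs_graphD)
    show "arcs (underlying H) = arcs (underlying K)" "einv H = einv K"
      using sim by (simp_all add: similar_def)
    show "ends H e = ends K e" if "e \<in> arcs (underlying K)"
      "atail K e \<in> Q \<or> ahead K e \<in> Q \<or> atail H e \<in> Q \<or> ahead H e \<in> Q" for e
      using agree touch[OF sim(1), of e] touch[OF sim(2), of e] that sim by (auto simp: similar_def)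
  qed
qed

lemma gbs_iso_over_primes_of:
  assumes "gbs_iso_over \<beta> G H" shows "primes_of H = primes_of G"
proof -
  obtain \<phi> where "\<phi> ` arcs (underlying G) = arcs (underlying H)"
    and "\<forall>e \<in> arcs (underlying G). label H (\<phi> e) = label G e"
    using assms unfolding gbs_iso_over_def bij_betw_def by blast
  then show ?thesis unfolding primes_of_def by (auto simp flip: \<open>_ = arcs (underlying H)\<close>)
qed

lemma gbs_iso_over_configuration:
  assumes "affine_graph G" "affine_graph H" and iso: "gbs_iso_over \<beta> G H"
    and Q: "Q \<subseteq> points G"
  shows "configuration H (point_map \<beta> ` Q) = image_mset (image (point_map \<beta>)) (configuration G Q)"
proof -
  interpret G: affine_graph G by fact
  interpret H: affine_graph H by fact
  let ?A = "arcs (underlying G)"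
  obtain \<phi> where \<beta>: "inj_on \<beta> (verts (underlying G))" and \<phi>: "inj_on \<phi> ?A" "\<phi> ` ?A = arcs (underlying H)"
    and inv: "\<And>e. e \<in> ?A \<Longrightarrow> einv H (\<phi> e) = \<phi> (einv G e)"
    and comp: "\<And>e. e \<in> ?A \<Longrightarrow> head (underlying H) (\<phi> e) = \<beta> (head (underlying G) e)"
      "\<And>e. e \<in> ?A \<Longrightarrow> label H (\<phi> e) = label G e"
    using iso unfolding gbs_iso_over_def bij_betw_def by metis
  have hd: "ahead H (\<phi> e) = point_map \<beta> (ahead G e)" if "e \<in> ?A" for e
    using comp[OF that] by (intro prod_eqI) (simp_all add: fst_ahead snd_ahead point_map_def)
  have tl: "atail H (\<phi> e) = point_map \<beta> (atail G e)" if "e \<in> ?A" for e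
    using hd[of "einv G e"] inv[OF that] that ahead_einv[of H "\<phi> e"] by simp
  have inj: "inj_on (point_map \<beta>) (points G)"
    using \<beta> by (auto simp: inj_on_def point_map_def points_def)
  have inQ: "point_map \<beta> p \<in> point_map \<beta> ` Q \<longleftrightarrow> p \<in> Q" if "p \<in> points G" for p
    using inj_on_image_mem_iff[OF inj that Q] .
  define DG where "DG = {{e, einv G e} |e. e \<in> arcs (affine_rep G) \<and> (atail G e \<in> Q \<or> ahead G e \<in> Q)}"
  define DH where "DH = {{e, einv H e} |e. e \<in> arcs (affine_rep H) \<and>
    (atail H e \<in> point_map \<beta> ` Q \<or> ahead H e \<in> point_map \<beta> ` Q)}"
  have DG: "d \<subseteq> ?A" if "d \<in> DG" for d using that by (auto simp: DG_def)
  have "DH = (\<lambda>d. \<phi> ` d) ` DG"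
  proof (intro equalityI subsetI)
    fix x assume "x \<in> DH"
    then have "\<exists>y \<in> \<phi> ` ?A. x = {y, einv H y} \<and> (atail H y \<in> point_map \<beta> ` Q \<or> ahead H y \<in> point_map \<beta> ` Q)"
      unfolding \<phi>(2) DH_def by simp blast
    then obtain e where e: "e \<in> ?A" "x = {\<phi> e, einv H (\<phi> e)}"
      "atail H (\<phi> e) \<in> point_map \<beta> ` Q \<or> ahead H (\<phi> e) \<in> point_map \<beta> ` Q"
      by blast
    then have "{e, einv G e} \<in> DG" using hd tl inQ by (auto simp: DG_def)
    moreover have "x = \<phi> ` {e, einv G e}" using e inv by simp
    ultimately show "x \<in> (\<lambda>d. \<phi> ` d) ` DG" by blast
  next
    fix x assume "x \<in> (\<lambda>d. \<phi> ` d) ` DG"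
    then obtain e where e: "e \<in> ?A" "x = \<phi> ` {e, einv G e}" "atail G e \<in> Q \<or> ahead G e \<in> Q"
      by (auto simp: DG_def)
    then have "x = {\<phi> e, einv H (\<phi> e)}" "\<phi> e \<in> arcs (underlying H)"
      "atail H (\<phi> e) \<in> point_map \<beta> ` Q \<or> ahead H (\<phi> e) \<in> point_map \<beta> ` Q"
      using inv hd tl \<phi>(2) by auto
    then show "x \<in> DH" by (auto simp: DH_def)
  qed
  moreover have "inj_on (\<lambda>d. \<phi> ` d) DG"
    using DG \<phi>(1) by (intro inj_onI) (simp add: inj_on_image_eq_iff)
  ultimately have DH: "mset_set DH = image_mset (\<lambda>d. \<phi> ` d) (mset_set DG)"
    by (simp add: image_mset_mset_set)
  have fin: "finite DG"
    by (rule finite_subset[of _ "geom_edges G"]) (auto simp: geom_edges_def DG_def)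
  have "image_mset (\<lambda>d. atail H ` \<phi> ` d) (mset_set DG) =
      image_mset (\<lambda>d. point_map \<beta> ` atail G ` d) (mset_set DG)"
  proof (rule image_mset_cong)
    fix d assume "d \<in># mset_set DG"
    then have "d \<subseteq> ?A" using DG fin by simp
    then show "atail H ` \<phi> ` d = point_map \<beta> ` atail G ` d"
      unfolding image_image by (intro image_cong refl tl) blast
  qed
  then show ?thesis
    unfolding configuration_def DG_def[symmetric] DH_def[symmetric] DH
    by (simp add: multiset.map_comp o_def)
qed

text \<open>
  The classes are treated one at a time, each by the moves given for it; the edges of the classes treated
  before, and those of the classes still to come, stay as they are.
\<close>

lemma moves_realising_all_classes:
  assumes G: "gbs_graph G"
    and H: "\<And>Q. Q \<in> quasi_conj_classes G \<Longrightarrow> (move_within Q)\<^sup>*\<^sup>* G (H Q)"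
  shows "\<exists>K. gbs_move\<^sup>*\<^sup>* G K \<and>
    (\<forall>Q \<in> quasi_conj_classes G. \<forall>x \<in> edges_of_class G Q. ends K x = ends (H Q) x)"
proof -
  interpret G: affine_graph G using G by (rule gbs_graphD)
  \<comment> \<open>Only the finitely many classes that contain an edge matter.\<close>
  define C where "C = (\<lambda>e. {q. quasi_conj G (atail G e) q}) ` arcs (underlying G)"
  have C: "C \<subseteq> quasi_conj_classes G"
    unfolding C_def by (intro image_subsetI G.quasi_conj_classI G.atail_in_points)
  have cls: "Q = {q. quasi_conj G (atail G x) q}" if "Q \<in> quasi_conj_classes G" "x \<in> edges_of_class G Q" for Q x
    using G.quasi_conj_classD(2)[OF that(1), of "atail G x"] that(2) by (auto simp: edges_of_class_def)
  have fin: "finite C" by (simp add: C_def)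
  have "\<exists>K. gbs_move\<^sup>*\<^sup>* G K \<and> (\<forall>Q \<in> F. \<forall>x \<in> edges_of_class G Q. ends K x = ends (H Q) x) \<and>
      (\<forall>Q \<in> C - F. \<forall>x \<in> edges_of_class G Q. ends K x = ends G x)" if "F \<subseteq> C" for F
    using finite_subset[OF that fin] that
  proof (induction F rule: finite_induct)
    case (insert Q F)
    then obtain K where K: "gbs_move\<^sup>*\<^sup>* G K" "\<forall>Q \<in> F. \<forall>x \<in> edges_of_class G Q. ends K x = ends (H Q) x"
      "\<forall>Q \<in> C - F. \<forall>x \<in> edges_of_class G Q. ends K x = ends G x" by blast
    have Q: "Q \<in> quasi_conj_classes G" "Q \<in> C - F" using insert C by auto
    obtain K' where K': "gbs_move\<^sup>*\<^sup>* K K'" "\<forall>x \<in> edges_of_class G Q. ends K' x = ends (H Q) x"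
      "\<forall>x \<in> arcs (underlying G) - edges_of_class G Q. ends K' x = ends K x"
      using moves_within_elsewhere[OF H[OF Q(1)] similar_gbs_moves[OF K(1) G] Q(1)] K(3) Q(2) by blast
    have off: "ends K' x = ends K x" if "R \<in> C" "R \<noteq> Q" "x \<in> edges_of_class G R" for R x
    proof -
      have "x \<notin> edges_of_class G Q" using cls[OF Q(1), of x] cls[of R x] that C by blast
      with that K'(3) show ?thesis by (auto simp: edges_of_class_def)
    qed
    have "gbs_move\<^sup>*\<^sup>* G K'" using K(1) K'(1) by simp
    moreover have "\<forall>R \<in> insert Q F. \<forall>x \<in> edges_of_class G R. ends K' x = ends (H R) x"
    proof (intro ballI)
      fix R x assume R: "R \<in> insert Q F" "x \<in> edges_of_class G R"
      show "ends K' x = ends (H R) x"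
      proof (cases "R = Q")
        case False
        with R K(2) off[of R x] insert.prems show ?thesis by auto
      qed (use R K'(2) in simp)
    qed
    moreover have "\<forall>R \<in> C - insert Q F. \<forall>x \<in> edges_of_class G R. ends K' x = ends G x"
    proof (intro ballI)
      fix R x assume R: "R \<in> C - insert Q F" "x \<in> edges_of_class G R"
      then have "R \<in> C" "R \<noteq> Q" "R \<in> C - F" by blast+
      then show "ends K' x = ends G x" using off[OF _ _ R(2)] K(3) R(2) by simp
    qed
    ultimately show ?case by blast
  qed blast
  from this[OF order_refl] obtain K where "gbs_move\<^sup>*\<^sup>* G K"
    "\<forall>Q \<in> C. \<forall>x \<in> edges_of_class G Q. ends K x = ends (H Q) x" by blast
  moreover have "Q \<in> C" if "Q \<in> quasi_conj_classes G" "x \<in> edges_of_class G Q" for Q x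
    using cls[OF that] that(2) by (auto simp: C_def edges_of_class_def)
  ultimately show ?thesis by blast
qed

theorem theorem3:
  fixes G :: "('v, 'e) pre_gbs" and G' :: "('w, 'f) pre_gbs" and \<beta> :: "'v \<Rightarrow> 'w"
  assumes "gbs_graph G" and "gbs_graph G'"
    and "bij_betw \<beta> (verts (underlying G)) (verts (underlying G'))"
  shows
    "(\<exists>H. gbs_move\<^sup>*\<^sup>* G H \<and> gbs_iso_over \<beta> H G') \<longleftrightarrow>
     primes_of G = primes_of G' \<and>
     (\<forall>Q \<in> quasi_conj_classes G. \<exists>H. (move_within Q)\<^sup>*\<^sup>* G H \<and>
        image_mset (image (point_map \<beta>)) (configuration H Q) =
          configuration G' (point_map \<beta> ` Q))"
    (is "?moves \<longleftrightarrow> ?primes \<and> ?classes")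
proof
  interpret G: affine_graph G using assms(1) by (rule gbs_graphD)
  assume ?moves
  then obtain H where H: "gbs_move\<^sup>*\<^sup>* G H" and iso: "gbs_iso_over \<beta> H G'" by blast
  have GH: "similar G H" by (rule similar_gbs_moves[OF H assms(1)])
  have ?primes using gbs_iso_over_primes_of[OF iso] GH by (simp add: similar_def)
  moreover have ?classes
  proof
    fix Q assume Q: "Q \<in> quasi_conj_classes G"
    obtain K where K: "(move_within Q)\<^sup>*\<^sup>* G K" "similar G K" "\<forall>x \<in> edges_of_class G Q. ends K x = ends H x"
      using moves_seen_from_class[OF H assms(1) Q] by blast
    have "configuration K Q = configuration H Q"
      by (rule similar_configuration[OF K(2) GH Q K(3)])
    moreover have "Q \<subseteq> points H"
      using G.quasi_conj_classD(1)[OF Q] similarD(1)[OF GH] by blast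
    then have "configuration G' (point_map \<beta> ` Q) = image_mset (image (point_map \<beta>)) (configuration H Q)"
      using gbs_iso_over_configuration[OF _ _ iso] GH assms(2) by (simp add: similar_def gbs_graphD)
    ultimately show "\<exists>H. (move_within Q)\<^sup>*\<^sup>* G H \<and>
        image_mset (image (point_map \<beta>)) (configuration H Q) = configuration G' (point_map \<beta> ` Q)"
      using K(1) by auto
  qed
  ultimately show "?primes \<and> ?classes" by blast
next
  interpret G: affine_graph G using assms(1) by (rule gbs_graphD)
  interpret G': affine_graph G' using assms(2) by (rule gbs_graphD)
  assume R: "?primes \<and> ?classes"
  then obtain H where H: "\<And>Q. Q \<in> quasi_conj_classes G \<Longrightarrow> (move_within Q)\<^sup>*\<^sup>* G (H Q)"
    and conf: "\<And>Q. Q \<in> quasi_conj_classes G \<Longrightarrow>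
      image_mset (image (point_map \<beta>)) (configuration (H Q) Q) = configuration G' (point_map \<beta> ` Q)"
    by metis
  obtain K where K: "gbs_move\<^sup>*\<^sup>* G K"
    and KH: "\<And>Q x. Q \<in> quasi_conj_classes G \<Longrightarrow> x \<in> edges_of_class G Q \<Longrightarrow> ends K x = ends (H Q) x"
    using moves_realising_all_classes[of G H] assms(1) H by blast
  have GK: "similar G K" by (rule similar_gbs_moves[OF K assms(1)])
  interpret K: affine_graph K using GK by (simp add: similar_def gbs_graphD)
  have frame: "verts (underlying K) = verts (underlying G)" using GK by (simp add: similar_def)
  have confK: "image_mset (image (point_map \<beta>)) (configuration K Q) = configuration G' (point_map \<beta> ` Q)"
    if Q: "Q \<in> quasi_conj_classes G" for Q
  proof -
    have "similar G (H Q)" using H[OF Q]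
    proof (induction rule: rtranclp_induct)
      case (step L L')
      show ?case by (rule similar_trans[OF step.IH similar_move_within[OF step.hyps(2)]])
    qed (rule similar_refl[OF assms(1)])
    then have "configuration K Q = configuration (H Q) Q"
      using KH Q by (intro similar_configuration[OF GK _ Q]) auto
    then show ?thesis using conf[OF Q] by simp
  qed
  have inj: "inj_on (point_map \<beta>) (points G)"
    using assms(3) by (auto simp: inj_on_def point_map_def points_def bij_betw_def)
  have pts: "point_map \<beta> ` points G = points G'"
  proof -
    have "point_map \<beta> ` (A \<times> B) = (\<beta> ` A) \<times> B" for A B by (force simp: point_map_def)
    then show ?thesis using R assms(3) by (simp add: points_def bij_betw_def cone_def)
  qed
  define f where "f d = point_map \<beta> ` atail K ` d" for d
  have tails: "atail K ` d \<subseteq> points G" "d \<noteq> {}" if "d \<in> geom_edges K" for d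
    using K.atail_geom_edge[OF that] similarD(1)[OF GK] by simp_all
  \<comment> \<open>A nonempty endpoint set meets a class, and the configurations of that class count its edges on both sides.\<close>
  have fibres: "card {d \<in> geom_edges K. f d = X} = card {d \<in> geom_edges G'. atail G' ` d = X}" for X
  proof (cases "X \<subseteq> points G' \<and> X \<noteq> {}")
    case False
    have "f d \<noteq> X" if "d \<in> geom_edges K" for d
    proof -
      have "f d \<subseteq> points G'" "f d \<noteq> {}"
        using tails[OF that] unfolding f_def by (simp_all flip: pts add: image_mono)
      with False show ?thesis by blast
    qed
    moreover have "atail G' ` d \<noteq> X" if "d \<in> geom_edges G'" for d
      using G'.atail_geom_edge[OF that] False by blast
    ultimately have "{d \<in> geom_edges K. f d = X} = {}" "{d \<in> geom_edges G'. atail G' ` d = X} = {}" by auto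
    then show ?thesis by (simp only: card.empty)
  next
    case True
    then obtain Y where Y: "Y \<subseteq> points G" "X = point_map \<beta> ` Y" "Y \<noteq> {}"
      unfolding pts[symmetric] subset_image_iff by blast
    then obtain y where y: "y \<in> Y" by blast
    define Q where "Q = {q. quasi_conj G y q}"
    have Q: "Q \<in> quasi_conj_classes G" "y \<in> Q"
      using y Y(1) G.quasi_conj_classI[of y] G.quasi_conj_refl[of y] by (auto simp: Q_def)
    have "card {d \<in> geom_edges G'. atail G' ` d = X} = count (configuration G' (point_map \<beta> ` Q)) X"
      using y Q Y by (intro G'.count_configuration) auto
    also have "\<dots> = count (image_mset (image (point_map \<beta>)) (configuration K Q)) X"
      by (simp add: confK[OF Q(1)])
    also have "\<dots> = count (configuration K Q) Y"
    proof -
      have sub: "Z \<subseteq> points G" if "Z \<in># configuration K Q" for Z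
        using K.configuration_points[OF that] similarD(1)[OF GK] by simp
      have "{Z \<in> set_mset (configuration K Q). point_map \<beta> ` Z = X} = set_mset (configuration K Q) \<inter> {Y}"
        using inj_on_image_eq_iff[OF inj sub Y(1)] unfolding Y(2) by blast
      then have "count (image_mset (image (point_map \<beta>)) (configuration K Q)) X =
          (\<Sum>Z \<in> set_mset (configuration K Q) \<inter> {Y}. count (configuration K Q) Z)"
        unfolding count_image_mset by (intro sum.cong refl) blast
      then show ?thesis
        by (cases "Y \<in># configuration K Q") (simp_all add: not_in_iff)
    qed
    also have "\<dots> = card {d \<in> geom_edges K. atail K ` d = Y}"
      using K.count_configuration[OF y Q(2)] by simp
    also have "{d \<in> geom_edges K. atail K ` d = Y} = {d \<in> geom_edges K. f d = X}"
      using inj_on_image_eq_iff[OF inj tails(1) Y(1)] unfolding f_def Y(2) by blast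
    finally show ?thesis by simp
  qed
  have "finite (geom_edges K)" "finite (geom_edges G')" by (simp_all add: geom_edges_def)
  then obtain \<Phi> where "bij_betw \<Phi> (geom_edges K) (geom_edges G')"
    "\<And>d. d \<in> geom_edges K \<Longrightarrow> atail G' ` \<Phi> d = f d"
    using bij_betw_if_card_fibres_eq[of "geom_edges K" "geom_edges G'" f "\<lambda>d. atail G' ` d"] fibres by blast
  then have "gbs_iso_over \<beta> K G'"
    using assms(3) frame
    by (intro gbs_iso_over_if_ends_match[OF K.affine_graph_axioms G'.affine_graph_axioms]) (simp_all add: f_def)
  with K show ?moves by blast
qed

end
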